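(* Let $K$ be a finite field, let $S=K[t_1,\ldots,t_s]$, let $X=\{P_1,\ldots,P_m\}$ be a subset of $K^s$ with $m=|X|\geq 2$, let $I=I(X)$ be its vanishing ideal, let $r_0$ be the regularity index of $H_I^a$, and let $\prec$ be a graded monomial order on $S$. The following conditions are equivalent. (a) $C_X(d)$ is monomially equivalent to $C_X(r_0-d-1)^\perp$ for all integers $-1\leq d\leq r_0$. (b) $H_I^a(d)+H_I^a(r_0-d-1)=|X|$ for all integers $-1\leq d\leq r_0$, and $r_0=\mathrm{v}_{\mathfrak{p}}(I)$ for all $\mathfrak{p}\in\mathrm{Ass}(I)$. (c) There is $g\in K\Delta_\prec(I)$ such that $g(P_i)\neq 0$ for all $i$ and $$C_X(r_0-d-1)^\perp=(g(P_1),\ldots,g(P_m))\cdot C_X(d)\quad\text{for all integers } -1\leq d\leq r_0.$$ Moreover, one can choose $g=\sum_{i=1}^m\mathrm{lc}(f_i)f_i$, where $f_i$ is the $i$-th standard indicator function and $\mathrm{lc}(f_i)$ is its leading coefficient.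
   Context: $I(X)$ is the ideal of all polynomials vanishing on $X$. A graded monomial order compares monomials first by total degree. $\Delta_\prec(I)$ is the set of standard monomials of $S/I$ (monomials not in $\mathrm{in}_\prec(I)$), and $K\Delta_\prec(I)$ is its $K$-span. Leading coefficients are with respect to $\prec$. For $d\ge 0$, $S_{\le d}$ is the space of polynomials of total degree at most $d$ (including $0$); $S_{\le -1}=\{0\}$; $I_{\le d}=I\cap S_{\le d}$. The affine Hilbert function is $H_I^a(d)=\dim_K(S_{\le d}/I_{\le d})$ for $d\ge -1$ (so $H_I^a(-1)=0$). Its regularity index $r_0=\mathrm{reg}(H_I^a)$ is the least integer $\ell\geq 0$ such that $H_I^a(d)=|X|$ for all $d\ge\ell$. The Reed--Muller-type code of degree $d$ is $C_X(d)=\{(f(P_1),\ldots,f(P_m)): f\in S_{\le d}\}\subset K^m$; in particular $C_X(-1)=(0)$. For a linear code $C\subset K^m$, $C^\perp$ is its dual for the ordinary inner product. For $\beta\in K^m$, $\beta\cdot C=\{(\beta_1c_1,\ldots,\beta_mc_m): c\in C\}$. Codes $C_1,C_2\subset K^m$ are monomially equivalent if $C_2=\beta\cdot C_1$ for some $\beta\in K^m$ with all $\beta_i\ne 0$. The set $\mathrm{Ass}(I)$ of associated primes of $I$ is $\{\mathfrak{p}_1,\ldots,\mathfrak{p}_m\}$, where $\mathfrak{p}_i$ is the vanishing ideal of $P_i$. For $\mathfrak{p}\in\mathrm{Ass}(I)$, $\mathrm{v}_{\mathfrak{p}}(I)=\min\{d\ge 0: \exists\, 0\ne f\in S,\ \deg(f)=d,\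 (I\colon f)=\mathfrak{p}\}$, where $(I\colon f)=\{g\in S: gf\in I\}$. The $i$-th standard indicator function $f_i$ is the unique polynomial in $K\Delta_\prec(I)$ with $f_i(P_i)=1$ and $f_i(P_j)=0$ for $j\neq i$. *)

theory Defs
  imports "HOL-Library.Poly_Mapping" "HOL-Analysis.Finite_Cartesian_Product"
begin

text \<open>The polynomial ring in \<open>CARD('n)\<close> variables over \<open>'k\<close> is modelled by finitely supported
  functions from exponent vectors to coefficients; its ring structure is the convolution product
  of the library.\<close>

type_synonym 'n monom = "'n \<Rightarrow>\<^sub>0 nat"
type_synonym ('n, 'k) mpoly = "'n monom \<Rightarrow>\<^sub>0 'k"

definition pscale :: "'k::field \<Rightarrow> ('n, 'k) mpoly \<Rightarrow> ('n, 'k) mpoly" where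
  "pscale c f = Poly_Mapping.single 0 c * f"

global_interpretation poly_vs: vector_space "pscale :: 'k::field \<Rightarrow> ('n, 'k) mpoly \<Rightarrow> ('n, 'k) mpoly"
  by standard
    (simp_all add: pscale_def distrib_left distrib_right single_add mult_single single_one
      flip: mult.assoc)

text \<open>Ideals of a commutative ring are the submodules of the ring over itself.\<close>

global_interpretation ring_ideal: module "(*) :: 'a::comm_ring_1 \<Rightarrow> 'a \<Rightarrow> 'a"
  by standard (simp_all add: algebra_simps)

definition monom_deg :: "'n::finite monom \<Rightarrow> nat" where
  "monom_deg a = (\<Sum>i\<in>UNIV. Poly_Mapping.lookup a i)"

definition poly_eval :: "('n::finite, 'k::field) mpoly \<Rightarrow> 'k ^ 'n \<Rightarrow> 'k" where
  "poly_eval f x = (\<Sum>a\<in>Poly_Mapping.keys f.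
     Poly_Mapping.lookup f a * (\<Prod>i\<in>UNIV. (x $ i) ^ Poly_Mapping.lookup a i))"

text \<open>Only used for nonzero polynomials.\<close>

definition total_deg :: "('n::finite, 'k::field) mpoly \<Rightarrow> nat" where
  "total_deg f = Max (monom_deg ` Poly_Mapping.keys f)"

text \<open>For negative \<open>d\<close> this is \<open>{0}\<close>.\<close>

definition polys_le :: "int \<Rightarrow> ('n::finite, 'k::field) mpoly set" where
  "polys_le d = {f. \<forall>a\<in>Poly_Mapping.keys f. int (monom_deg a) \<le> d}"

definition vanishing_ideal :: "('k ^ 'n) set \<Rightarrow> ('n::finite, 'k::field) mpoly set" where
  "vanishing_ideal X = {f. \<forall>x\<in>X. poly_eval f x = 0}"

text \<open>The residue classes of the elements of \<open>B\<close> are pairwise distinct and form a basis of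
  \<open>V / W\<close>: every class in \<open>V / W\<close> is a linear combination of them with unique coefficients.\<close>

definition quotient_basis ::
    "('n, 'k::field) mpoly set \<Rightarrow> ('n, 'k) mpoly set \<Rightarrow> ('n, 'k) mpoly set \<Rightarrow> bool" where
  "quotient_basis V W B \<longleftrightarrow> finite B \<and> B \<subseteq> V \<and>
     (\<forall>v\<in>V. \<exists>!c. (\<forall>b. b \<notin> B \<longrightarrow> c b = 0) \<and> v - (\<Sum>b\<in>B. pscale (c b) b) \<in> W)"

definition quotient_dim :: "('n, 'k::field) mpoly set \<Rightarrow> ('n, 'k) mpoly set \<Rightarrow> nat" where
  "quotient_dim V W = (THE n. \<exists>B. quotient_basis V W B \<and> card B = n)"

definition affine_hilbert :: "('n::finite, 'k::field) mpoly set \<Rightarrow> int \<Rightarrow> nat" where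
  "affine_hilbert I d = quotient_dim (polys_le d) (I \<inter> polys_le d)"

text \<open>Least point from which on \<open>H\<close> is constantly \<open>c\<close>; used with \<open>c = |X|\<close>.\<close>

definition reg_index :: "(int \<Rightarrow> nat) \<Rightarrow> nat \<Rightarrow> nat" where
  "reg_index H c = (LEAST l. \<forall>d \<ge> int l. H d = c)"

definition RM_code :: "('m \<Rightarrow> 'k ^ 'n) \<Rightarrow> int \<Rightarrow> ('k::field ^ 'm::finite) set" where
  "RM_code P d = {(\<chi> i. poly_eval f (P i)) | f :: ('n::finite, 'k) mpoly. f \<in> polys_le d}"

definition dual_code :: "('k::field ^ 'm::finite) set \<Rightarrow> ('k ^ 'm) set" where
  "dual_code C = {v. \<forall>c\<in>C. (\<Sum>i\<in>UNIV. v $ i * c $ i) = 0}"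

definition scale_code :: "'k::field ^ 'm::finite \<Rightarrow> ('k ^ 'm) set \<Rightarrow> ('k ^ 'm) set" where
  "scale_code \<beta> C = (\<lambda>c. \<chi> i. \<beta> $ i * c $ i) ` C"

definition monomially_equivalent :: "('k::field ^ 'm::finite) set \<Rightarrow> ('k ^ 'm) set \<Rightarrow> bool" where
  "monomially_equivalent C1 C2 \<longleftrightarrow> (\<exists>\<beta>. (\<forall>i. \<beta> $ i \<noteq> 0) \<and> C2 = scale_code \<beta> C1)"

definition colon_ideal :: "'a::comm_ring_1 set \<Rightarrow> 'a \<Rightarrow> 'a set" where
  "colon_ideal I f = {g. g * f \<in> I}"

definition prime_ideal :: "'a::comm_ring_1 set \<Rightarrow> bool" where
  "prime_ideal p \<longleftrightarrow> ring_ideal.subspace p \<and> p \<noteq> UNIV \<and>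
     (\<forall>a b. a * b \<in> p \<longrightarrow> a \<in> p \<or> b \<in> p)"

definition assoc_primes :: "'a::comm_ring_1 set \<Rightarrow> 'a set set" where
  "assoc_primes I = {p. prime_ideal p \<and> (\<exists>f. p = colon_ideal I f)}"

definition v_number :: "('n::finite, 'k::field) mpoly set \<Rightarrow> ('n, 'k) mpoly set \<Rightarrow> nat" where
  "v_number p I = (LEAST d. \<exists>f. f \<noteq> 0 \<and> total_deg f = d \<and> colon_ideal I f = p)"

definition monomial_order :: "('n monom \<Rightarrow> 'n monom \<Rightarrow> bool) \<Rightarrow> bool" where
  "monomial_order lt \<longleftrightarrow> irreflp lt \<and> transp lt \<and> totalp lt \<and> wfp lt \<and>
     (\<forall>a b c. lt a b \<longrightarrow> lt (a + c) (b + c))"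

definition graded_monomial_order :: "('n::finite monom \<Rightarrow> 'n monom \<Rightarrow> bool) \<Rightarrow> bool" where
  "graded_monomial_order lt \<longleftrightarrow> monomial_order lt \<and>
     (\<forall>a b. monom_deg a < monom_deg b \<longrightarrow> lt a b)"

text \<open>Leading monomials are only used for nonzero polynomials.\<close>

definition lead_monom :: "('n monom \<Rightarrow> 'n monom \<Rightarrow> bool) \<Rightarrow> ('n, 'k::field) mpoly \<Rightarrow> 'n monom" where
  "lead_monom lt f = (THE a. a \<in> Poly_Mapping.keys f \<and>
     (\<forall>b\<in>Poly_Mapping.keys f. b \<noteq> a \<longrightarrow> lt b a))"

definition lead_coef :: "('n monom \<Rightarrow> 'n monom \<Rightarrow> bool) \<Rightarrow> ('n, 'k::field) mpoly \<Rightarrow> 'k" where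
  "lead_coef lt f = Poly_Mapping.lookup f (lead_monom lt f)"

definition initial_ideal ::
    "('n monom \<Rightarrow> 'n monom \<Rightarrow> bool) \<Rightarrow> ('n, 'k::field) mpoly set \<Rightarrow> ('n, 'k) mpoly set" where
  "initial_ideal lt I =
     ring_ideal.span {Poly_Mapping.single (lead_monom lt f) 1 | f. f \<in> I \<and> f \<noteq> 0}"

definition std_monoms ::
    "('n monom \<Rightarrow> 'n monom \<Rightarrow> bool) \<Rightarrow> ('n, 'k::field) mpoly set \<Rightarrow> 'n monom set" where
  "std_monoms lt I = {a. Poly_Mapping.single a 1 \<notin> initial_ideal lt I}"

definition std_span ::
    "('n monom \<Rightarrow> 'n monom \<Rightarrow> bool) \<Rightarrow> ('n, 'k::field) mpoly set \<Rightarrow> ('n, 'k) mpoly set" where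
  "std_span lt I = poly_vs.span ((\<lambda>a. Poly_Mapping.single a 1) ` std_monoms lt I)"

definition std_indicator ::
    "('n monom \<Rightarrow> 'n monom \<Rightarrow> bool) \<Rightarrow> ('m \<Rightarrow> 'k::field ^ 'n::finite) \<Rightarrow> 'm \<Rightarrow> ('n, 'k) mpoly" where
  "std_indicator lt P i = (THE f. f \<in> std_span lt (vanishing_ideal (range P)) \<and>
     poly_eval f (P i) = 1 \<and> (\<forall>j. j \<noteq> i \<longrightarrow> poly_eval f (P j) = 0))"

end

theory Submission
  imports Defs "HOL-Analysis.Cartesian_Space"
begin

text \<open>Everything is linear algebra in \<open>K\<^sup>m\<close>, into which polynomials are sent by evaluation at the
  points. Write \<open>C\<^sub>d\<close> for the code of degree \<open>d\<close>. Since the order is graded, dividing by the vanishing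
  ideal does not raise the degree, so the standard monomials of degree at most \<open>d\<close> evaluate to a
  basis of \<open>C\<^sub>d\<close>; the affine Hilbert function at \<open>d\<close> is both their number and \<open>dim C\<^sub>d\<close>
  (\<open>affine_hilbert_eq_dim\<close>, \<open>dim_eq_card_std_monoms\<close>). Let \<open>\<pp>\<^sub>i\<close> be the
  vanishing ideal of the \<open>i\<close>-th point. The colon ideal of a polynomial is \<open>\<pp>\<^sub>i\<close> iff the polynomial is
  nonzero at this point and zero at all others. Hence the v-number at
  \<open>\<pp>\<^sub>i\<close> is at most \<open>d\<close> iff the \<open>i\<close>-th unit vector lies in \<open>C\<^sub>d\<close> (\<open>v_number_le_iff\<close>), and, as the code
  of degree \<open>r\<^sub>0\<close> is everything, it equals \<open>r\<^sub>0\<close> iff that unit vector is not in the code of degree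
  \<open>r\<^sub>0 - 1\<close>.

  (a) implies (b): a code and its dual have complementary dimensions, and rescaling by nonzero
  factors keeps the dimension; this is the identity for the Hilbert function. For \<open>d = 0\<close> the scaling
  vector \<open>\<beta>\<close> is itself in the dual of the code of degree \<open>r\<^sub>0 - 1\<close>, because \<open>C\<^sub>0\<close> contains the all-ones
  vector. A unit vector pairs with \<open>\<beta>\<close> to one of its nonzero entries, so it is not in that code.

  (b) implies (c) for the explicit \<open>g\<close>: since \<open>dim C\<^sub>0 = 1\<close>, the code of degree \<open>r\<^sub>0 - 1\<close> has codimension
  one, so there is a single standard monomial \<open>a\<close> of degree \<open>r\<^sub>0\<close>. No standard indicator function has
  degree below \<open>r\<^sub>0\<close>, so \<open>a\<close> is the leading monomial of all of them, and \<open>\<beta>\<^sub>i = lc(f\<^sub>i)\<close> is the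
  coefficient of \<open>a\<close> in \<open>f\<^sub>i\<close>. The standard polynomial with values \<open>c\<close> is \<open>\<Sum>\<^sub>i c\<^sub>i f\<^sub>i\<close>; when \<open>c\<close> has degree
  at most \<open>r\<^sub>0 - 1\<close>, the monomial \<open>a\<close> does not occur in it, which says \<open>\<Sum>\<^sub>i \<beta>\<^sub>i c\<^sub>i = 0\<close>
  (\<open>lead_coef_std_indicator\<close>). Applied to products of polynomials of degrees \<open>d\<close> and \<open>r\<^sub>0 - d - 1\<close> this
  puts \<open>\<beta> \<cdot> C\<^sub>d\<close> inside the dual of the code of degree \<open>r\<^sub>0 - d - 1\<close>, and the dimensions agree
  (\<open>dual_RM_code_eq_scaled\<close>). Finally, (c) implies (a) with the values of \<open>g\<close> as the scaling vector.\<close>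

text \<open>As a simplification rule this rewrites \<open>a * (b * c)\<close> to \<open>a * b * c\<close> in every commutative ring,
  against the orientation of \<open>mult.assoc\<close>; the two together do not terminate.\<close>
declare ring_ideal.scale_scale [simp del]

section \<open>Evaluation of polynomials\<close>

lemma poly_eval_eq_sum:
  assumes "finite A" "Poly_Mapping.keys f \<subseteq> A"
  shows "poly_eval f x =
    (\<Sum>a\<in>A. Poly_Mapping.lookup f a * (\<Prod>i\<in>UNIV. (x $ i) ^ Poly_Mapping.lookup a i))"
  unfolding poly_eval_def
  by (rule sum.mono_neutral_left) (use assms in \<open>auto simp: in_keys_iff\<close>)

lemma poly_eval_0 [simp]: "poly_eval 0 x = 0"
  by (simp add: poly_eval_def)

lemma poly_eval_add: "poly_eval (f + g) x = poly_eval f x + poly_eval g x"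
proof -
  let ?A = "Poly_Mapping.keys f \<union> Poly_Mapping.keys g"
  have "Poly_Mapping.keys (f + g) \<subseteq> ?A"
    by (rule Poly_Mapping.keys_add)
  then show ?thesis
    by (simp add: poly_eval_eq_sum[where A = ?A] lookup_add distrib_right sum.distrib)
qed

lemma poly_eval_single:
  "poly_eval (Poly_Mapping.single a c) x = c * (\<Prod>i\<in>UNIV. (x $ i) ^ Poly_Mapping.lookup a i)"
  by (simp add: poly_eval_eq_sum[where A = "{a}"])

lemma poly_eval_1 [simp]: "poly_eval 1 x = 1"
  using poly_eval_single[of 0 1 x] by simp

lemma poly_eval_sum: "poly_eval (sum f A) x = (\<Sum>a\<in>A. poly_eval (f a) x)"
  by (induction A rule: infinite_finite_induct) (simp_all add: poly_eval_add)

lemma poly_mapping_sum_single_superset: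
  assumes "finite A" "Poly_Mapping.keys f \<subseteq> A"
  shows "(\<Sum>a\<in>A. Poly_Mapping.single a (Poly_Mapping.lookup f a)) = f"
proof (rule poly_mapping_eqI)
  fix b
  have "(\<Sum>a\<in>A. Poly_Mapping.lookup (Poly_Mapping.single a (Poly_Mapping.lookup f a)) b) =
        (\<Sum>a\<in>A. if b = a then Poly_Mapping.lookup f a else 0)"
    by (intro sum.cong) (auto simp: lookup_single when_def)
  also have "\<dots> = Poly_Mapping.lookup f b"
    using assms by (auto simp: in_keys_iff)
  finally show "Poly_Mapping.lookup (\<Sum>a\<in>A. Poly_Mapping.single a (Poly_Mapping.lookup f a)) b =
      Poly_Mapping.lookup f b"
    by (simp add: lookup_sum)
qed

lemma poly_mapping_sum_single:
  "(\<Sum>a\<in>Poly_Mapping.keys f. Poly_Mapping.single a (Poly_Mapping.lookup f a)) = f"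
  by (rule poly_mapping_sum_single_superset) simp_all

lemma poly_eval_mult: "poly_eval (f * g) x = poly_eval f x * poly_eval g x"
proof -
  have single: "poly_eval (Poly_Mapping.single a c * Poly_Mapping.single b d) x =
      poly_eval (Poly_Mapping.single a c) x * poly_eval (Poly_Mapping.single b d) x" for a b c d
    unfolding mult_single poly_eval_single lookup_add power_add prod.distrib
    by (simp only: mult_ac)
  have "poly_eval (f * g) x =
    poly_eval ((\<Sum>a\<in>Poly_Mapping.keys f. Poly_Mapping.single a (Poly_Mapping.lookup f a)) *
      (\<Sum>b\<in>Poly_Mapping.keys g. Poly_Mapping.single b (Poly_Mapping.lookup g b))) x"
    by (simp only: poly_mapping_sum_single)
  also have "\<dots> =
    poly_eval (\<Sum>a\<in>Poly_Mapping.keys f. Poly_Mapping.single a (Poly_Mapping.lookup f a)) x *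
    poly_eval (\<Sum>b\<in>Poly_Mapping.keys g. Poly_Mapping.single b (Poly_Mapping.lookup g b)) x"
    unfolding sum_product poly_eval_sum single ..
  also have "\<dots> = poly_eval f x * poly_eval g x"
    by (simp only: poly_mapping_sum_single)
  finally show ?thesis .
qed

lemma poly_eval_pscale [simp]: "poly_eval (pscale c f) x = c * poly_eval f x"
  by (simp add: pscale_def poly_eval_mult poly_eval_single)

lemma poly_eval_uminus: "poly_eval (- f) x = - poly_eval f x"
  using minus_unique[of "poly_eval f x" "poly_eval (- f) x"] poly_eval_add[of f "- f" x] by simp

lemma poly_eval_diff: "poly_eval (f - g) x = poly_eval f x - poly_eval g x"
  using poly_eval_add[of f "- g" x] by (simp add: poly_eval_uminus)

lemma poly_eval_prod: "poly_eval (prod f A) x = (\<Prod>a\<in>A. poly_eval (f a) x)"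
  by (induction A rule: infinite_finite_induct) (simp_all add: poly_eval_mult)

lemma lookup_pscale [simp]:
  "Poly_Mapping.lookup (pscale c f) a = c * Poly_Mapping.lookup f a"
  unfolding pscale_def mult_map_scale_conv_mult[symmetric]
  by (simp add: Poly_Mapping.map.rep_eq when_def)

lemma keys_pscale: "Poly_Mapping.keys (pscale c f) \<subseteq> Poly_Mapping.keys f"
  by (auto simp: in_keys_iff)

lemma pscale_single: "pscale c (Poly_Mapping.single a d) = Poly_Mapping.single a (c * d)"
  by (simp add: pscale_def mult_single)

lemma keys_monom_mult:
  fixes f :: "('n, 'k::field) mpoly"
  shows "Poly_Mapping.keys (Poly_Mapping.single c 1 * f) = (+) c ` Poly_Mapping.keys f"
proof -
  have "Poly_Mapping.single c 1 * f =
      (\<Sum>a\<in>Poly_Mapping.keys f. Poly_Mapping.single (c + a) (Poly_Mapping.lookup f a))"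
    (is "?l = ?r")
    by (subst poly_mapping_sum_single[of f, symmetric]) (simp add: sum_distrib_left mult_single)
  moreover have "Poly_Mapping.lookup ?r (c + a) = Poly_Mapping.lookup f a" for a
    by (simp add: lookup_sum lookup_single when_def in_keys_iff)
  ultimately have "Poly_Mapping.lookup ?l (c + a) = Poly_Mapping.lookup f a" for a
    by simp
  then show ?thesis
    using keys_mult[of "Poly_Mapping.single c 1" f] by (auto simp: in_keys_iff) 
qed

definition eval_vec :: "('m::finite \<Rightarrow> 'k::field ^ 'n::finite) \<Rightarrow> ('n, 'k) mpoly \<Rightarrow> 'k ^ 'm" where
  "eval_vec P f = (\<chi> i. poly_eval f (P i))"

lemma eval_vec_nth [simp]: "eval_vec P f $ i = poly_eval f (P i)"
  by (simp add: eval_vec_def)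

lemma linear_eval_vec: "Vector_Spaces.linear pscale (*s) (eval_vec P)"
  by unfold_locales (simp_all add: vec_eq_iff poly_eval_add)

lemma RM_code_eq_image: "RM_code P d = eval_vec P ` polys_le d"
  by (auto simp: RM_code_def eval_vec_def)

section \<open>Total degree\<close>

lemma monom_deg_add: "monom_deg (a + b) = monom_deg a + monom_deg b"
  by (simp add: monom_deg_def lookup_add sum.distrib)

lemma subspace_polys_le: "poly_vs.subspace (polys_le d)"
  unfolding poly_vs.subspace_def polys_le_def
  by (auto dest!: subsetD[OF Poly_Mapping.keys_add] subsetD[OF keys_pscale])

lemma polys_le_mono: "d \<le> e \<Longrightarrow> polys_le d \<subseteq> polys_le e"
  by (auto simp: polys_le_def)

lemma polys_le_mult: "f \<in> polys_le d \<Longrightarrow> g \<in> polys_le e \<Longrightarrow> f * g \<in> polys_le (d + e)"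
proof -
  assume fg: "f \<in> polys_le d" "g \<in> polys_le e"
  show ?thesis
    unfolding polys_le_def
  proof clarsimp
    fix a assume "a \<in> Poly_Mapping.keys (f * g)"
    then obtain b c where "a = b + c" "b \<in> Poly_Mapping.keys f" "c \<in> Poly_Mapping.keys g"
      using keys_mult[of f g] by blast
    then show "int (monom_deg a) \<le> d + e"
      using fg by (auto simp: polys_le_def monom_deg_add intro!: add_mono)
  qed
qed

lemma one_in_polys_le: "0 \<le> d \<Longrightarrow> 1 \<in> polys_le d"
  by (simp add: polys_le_def monom_deg_def)

lemma total_deg_le_iff: "f \<noteq> 0 \<Longrightarrow> int (total_deg f) \<le> d \<longleftrightarrow> f \<in> polys_le d"
proof -
  assume "f \<noteq> 0"
  then have ne: "Poly_Mapping.keys f \<noteq> {}"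
    by simp
  show ?thesis
  proof (cases d)
    case (nonneg n)
    then show ?thesis using ne by (simp add: total_deg_def polys_le_def)
  next
    case (neg n)
    then show ?thesis using ne by (auto simp: polys_le_def)
  qed
qed

lemma ex_polys_le: "\<exists>d::nat. f \<in> polys_le (int d)"
proof (cases "f = 0")
  case True
  then show ?thesis by (simp add: polys_le_def)
next
  case False
  then show ?thesis using total_deg_le_iff[of f "int (total_deg f)"] by blast
qed

section \<open>Leading monomials and normal forms\<close>

lemma graded_imp_monomial_order: "graded_monomial_order lt \<Longrightarrow> monomial_order lt"
  by (simp add: graded_monomial_order_def)

lemma monomial_order_trans:
  assumes "monomial_order lt" "lt a b" "lt b c"
  shows "lt a c"
proof -
  have "transp lt"
    using assms(1) by (simp add: monomial_order_def)
  from transpD[OF this assms(2,3)] show ?thesis .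
qed

lemma monomial_order_asym:
  assumes "monomial_order lt" "lt a b"
  shows "\<not> lt b a"
proof
  assume "lt b a"
  then have "lt a a"
    using monomial_order_trans[OF assms(1)] assms(2) by metis
  moreover have "irreflp lt"
    using assms(1) by (simp add: monomial_order_def)
  ultimately show False
    by (simp add: irreflp_def)
qed

lemma monomial_order_total:
  assumes "monomial_order lt" "a \<noteq> b"
  shows "lt a b \<or> lt b a"
proof -
  have "totalp lt"
    using assms(1) by (simp add: monomial_order_def)
  from totalpD[OF this assms(2)] show ?thesis .
qed

lemma monomial_order_wf: "monomial_order lt \<Longrightarrow> wfp lt"
  by (simp add: monomial_order_def)

lemma monomial_order_add: "monomial_order lt \<Longrightarrow> lt a b \<Longrightarrow> lt (c + a) (c + b)"
  unfolding monomial_order_def add.commute[of c] by blast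

lemma graded_less_deg:
  assumes "graded_monomial_order lt" "lt a b"
  shows "monom_deg a \<le> monom_deg b"
proof (rule ccontr)
  assume "\<not> monom_deg a \<le> monom_deg b"
  then have "lt b a"
    using assms(1) by (simp add: graded_monomial_order_def)
  then show False
    using monomial_order_asym[OF graded_imp_monomial_order[OF assms(1)]] assms(2) by simp
qed

lemma finite_monom_max:
  assumes "monomial_order lt" "finite A" "A \<noteq> {}"
  shows "\<exists>a\<in>A. \<forall>b\<in>A. b \<noteq> a \<longrightarrow> lt b a"
  using assms(2,3)
proof (induction rule: finite_ne_induct)
  case (insert x F)
  then obtain a where a: "a \<in> F" "\<forall>b\<in>F. b \<noteq> a \<longrightarrow> lt b a" by blast
  show ?case
  proof (cases "lt x a")
    case True
    then show ?thesis using a by blast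
  next
    case False
    then have "lt a x"
      using monomial_order_total[OF assms(1), of x a] a(1) insert.hyps by blast
    then have "\<forall>b\<in>F. lt b x"
      using a(2) monomial_order_trans[OF assms(1)] by metis
    then show ?thesis by blast
  qed
qed simp

lemma lead_monom_eqI:
  assumes "monomial_order lt" "a \<in> Poly_Mapping.keys f"
    "\<And>b. b \<in> Poly_Mapping.keys f \<Longrightarrow> b \<noteq> a \<Longrightarrow> lt b a"
  shows "lead_monom lt f = a"
  unfolding lead_monom_def
proof (rule the_equality)
  show "a \<in> Poly_Mapping.keys f \<and> (\<forall>b\<in>Poly_Mapping.keys f. b \<noteq> a \<longrightarrow> lt b a)"
    using assms(2,3) by simp
  show "e = a"
    if "e \<in> Poly_Mapping.keys f \<and> (\<forall>b\<in>Poly_Mapping.keys f. b \<noteq> e \<longrightarrow> lt b e)" for e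
    using that assms(2,3) monomial_order_asym[OF assms(1)] by metis
qed

lemma
  assumes "monomial_order lt" "f \<noteq> 0"
  shows lead_monom_in_keys: "lead_monom lt f \<in> Poly_Mapping.keys f"
    and lt_lead_monom: "b \<in> Poly_Mapping.keys f \<Longrightarrow> b \<noteq> lead_monom lt f \<Longrightarrow> lt b (lead_monom lt f)"
proof -
  obtain a where a: "a \<in> Poly_Mapping.keys f" "\<forall>b\<in>Poly_Mapping.keys f. b \<noteq> a \<longrightarrow> lt b a"
    using finite_monom_max[OF assms(1), of "Poly_Mapping.keys f"] assms(2) by auto
  then have "lead_monom lt f = a"
    using lead_monom_eqI[OF assms(1)] by blast
  then show "lead_monom lt f \<in> Poly_Mapping.keys f"
    and "b \<in> Poly_Mapping.keys f \<Longrightarrow> b \<noteq> lead_monom lt f \<Longrightarrow> lt b (lead_monom lt f)"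
    using a by auto
qed

lemma lead_monom_monom_mult:
  fixes f :: "('n, 'k::field) mpoly"
  assumes "monomial_order lt" "f \<noteq> 0"
  shows "lead_monom lt (Poly_Mapping.single c 1 * f) = c + lead_monom lt f"
proof (rule lead_monom_eqI[OF assms(1)])
  show "c + lead_monom lt f \<in> Poly_Mapping.keys (Poly_Mapping.single c 1 * f)"
    by (simp add: keys_monom_mult lead_monom_in_keys[OF assms])
  show "lt b (c + lead_monom lt f)"
    if "b \<in> Poly_Mapping.keys (Poly_Mapping.single c 1 * f)" "b \<noteq> c + lead_monom lt f" for b
    using that lt_lead_monom[OF assms] monomial_order_add[OF assms(1)]
    by (auto simp: keys_monom_mult)
qed

lemma ideal_pscale: "ring_ideal.subspace I \<Longrightarrow> f \<in> I \<Longrightarrow> pscale c f \<in> I"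
  by (simp add: pscale_def ring_ideal.subspace_scale)

text \<open>The initial ideal is spanned by leading monomials as an ideal, yet this brings in no
  monomials besides leading ones: a product of an arbitrary monomial with the leading monomial of \<open>f \<in> I\<close>
  is the leading monomial of a multiple of \<open>f\<close>, again in \<open>I\<close>.\<close>
lemma initial_ideal_keys:
  fixes I :: "('n, 'k::field) mpoly set"
  assumes lt: "monomial_order lt" and I: "ring_ideal.subspace I"
    and h: "h \<in> initial_ideal lt I" "a \<in> Poly_Mapping.keys h"
  shows "\<exists>f\<in>I. f \<noteq> 0 \<and> lead_monom lt f = a"
proof -
  let ?T = "{h :: ('n, 'k) mpoly. \<forall>a\<in>Poly_Mapping.keys h. \<exists>f\<in>I. f \<noteq> 0 \<and> lead_monom lt f = a}"
  have "ring_ideal.subspace ?T"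
  proof (rule ring_ideal.subspaceI)
    show "x + y \<in> ?T" if "x \<in> ?T" "y \<in> ?T" for x y
      using that Poly_Mapping.keys_add[of x y] by blast
    show "c * x \<in> ?T" if x: "x \<in> ?T" for c x
    proof clarsimp
      fix e assume "e \<in> Poly_Mapping.keys (c * x)"
      then obtain a b where ab: "e = a + b" "b \<in> Poly_Mapping.keys x"
        using keys_mult[of c x] by auto
      then obtain f where f: "f \<in> I" "f \<noteq> 0" "lead_monom lt f = b"
        using x by auto
      have "Poly_Mapping.single a 1 * f \<noteq> 0"
        using f(2) by (simp add: keys_monom_mult flip: keys_eq_empty)
      moreover have "lead_monom lt (Poly_Mapping.single a 1 * f) = e"
        using f(3) ab(1) lead_monom_monom_mult[OF lt f(2)] by simp
      ultimately show "\<exists>f\<in>I. f \<noteq> 0 \<and> lead_monom lt f = e"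
        using ring_ideal.subspace_scale[OF I f(1)] by (intro bexI conjI)
    qed
  qed simp
  then have "initial_ideal lt I \<subseteq> ?T"
    unfolding initial_ideal_def by (intro ring_ideal.span_minimal) auto
  then show ?thesis using h by blast
qed

lemma std_span_eq:
  fixes I :: "('n, 'k::field) mpoly set"
  shows "std_span lt I = {f. Poly_Mapping.keys f \<subseteq> std_monoms lt I}"
proof
  have "poly_vs.subspace {f :: ('n, 'k) mpoly. Poly_Mapping.keys f \<subseteq> std_monoms lt I}"
    unfolding poly_vs.subspace_def
    by (auto dest!: subsetD[OF Poly_Mapping.keys_add] subsetD[OF keys_pscale])
  then show "std_span lt I \<subseteq> {f. Poly_Mapping.keys f \<subseteq> std_monoms lt I}"
    unfolding std_span_def by (intro poly_vs.span_minimal) auto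
  show "{f. Poly_Mapping.keys f \<subseteq> std_monoms lt I} \<subseteq> std_span lt I"
  proof clarify
    fix f :: "('n, 'k) mpoly" assume f: "Poly_Mapping.keys f \<subseteq> std_monoms lt I"
    have "(\<Sum>a\<in>Poly_Mapping.keys f. pscale (Poly_Mapping.lookup f a) (Poly_Mapping.single a 1))
        \<in> std_span lt I"
      unfolding std_span_def using f
      by (intro poly_vs.span_sum poly_vs.span_scale poly_vs.span_base) auto
    then show "f \<in> std_span lt I"
      by (simp add: pscale_single poly_mapping_sum_single)
  qed
qed

lemma subspace_std_span: "poly_vs.subspace (std_span lt I)"
  by (simp add: std_span_def)

text \<open>The leading monomial of a nonzero element of \<open>I\<close> is not standard.\<close>
lemma std_span_Int_ideal:
  assumes "monomial_order lt" "f \<in> std_span lt I" "f \<in> I"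
  shows "f = 0"
proof (rule ccontr)
  assume "f \<noteq> 0"
  then have "lead_monom lt f \<in> std_monoms lt I"
    using assms lead_monom_in_keys by (auto simp: std_span_eq)
  moreover have "Poly_Mapping.single (lead_monom lt f) 1 \<in> initial_ideal lt I"
    unfolding initial_ideal_def using \<open>f \<noteq> 0\<close> assms(3) by (intro ring_ideal.span_base) auto
  ultimately show False
    by (simp add: std_monoms_def)
qed

text \<open>The division algorithm for a single monomial, by well-founded induction along the order: a
  nonstandard monomial is the leading monomial of some \<open>f \<in> I\<close>, and modulo \<open>f\<close> it becomes a
  combination of smaller monomials.\<close>
lemma monom_normal_form:
  fixes I :: "('n, 'k::field) mpoly set"
  assumes lt: "monomial_order lt" and I: "ring_ideal.subspace I"
  shows "\<exists>r\<in>std_span lt I. (\<forall>b\<in>Poly_Mapping.keys r. b = a \<or> lt b a) \<and>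
    Poly_Mapping.single a 1 - r \<in> I"
  using monomial_order_wf[OF lt]
proof (induction a rule: wfp_induct_rule)
  case (less a)
  show ?case
  proof (cases "a \<in> std_monoms lt I")
    case True
    then show ?thesis
      using ring_ideal.subspace_0[OF I]
      by (intro bexI[of _ "Poly_Mapping.single a 1"]) (auto simp: std_span_eq)
  next
    case False
    then have "Poly_Mapping.single a 1 \<in> initial_ideal lt I"
      by (simp add: std_monoms_def)
    then obtain f where f: "f \<in> I" "f \<noteq> 0" "lead_monom lt f = a"
      using initial_ideal_keys[OF lt I] by fastforce
    define c where "c = Poly_Mapping.lookup f a"
    have "c \<noteq> 0"
      using lead_monom_in_keys[OF lt f(2)] f(3) by (simp add: c_def in_keys_iff)
    \<comment> \<open>The normalised \<open>f\<close> cancels the monomial \<open>a\<close> and leaves smaller ones.\<close>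
    define h where "h = Poly_Mapping.single a 1 - pscale (inverse c) f"
    have h_keys: "lt b a" if "b \<in> Poly_Mapping.keys h" for b
    proof -
      have "b \<noteq> a"
        using that \<open>c \<noteq> 0\<close> by (auto simp: h_def in_keys_iff lookup_minus c_def)
      moreover have "b \<in> Poly_Mapping.keys f"
        using that \<open>b \<noteq> a\<close> by (auto simp: h_def in_keys_iff lookup_minus lookup_single)
      ultimately show ?thesis
        using lt_lead_monom[OF lt f(2)] f(3) by blast
    qed
    obtain R where R: "\<And>b. b \<in> Poly_Mapping.keys h \<Longrightarrow> R b \<in> std_span lt I"
      "\<And>b e. b \<in> Poly_Mapping.keys h \<Longrightarrow> e \<in> Poly_Mapping.keys (R b) \<Longrightarrow> e = b \<or> lt e b"
      "\<And>b. b \<in> Poly_Mapping.keys h \<Longrightarrow> Poly_Mapping.single b 1 - R b \<in> I"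
      using less.IH h_keys by metis
    define r where "r = (\<Sum>b\<in>Poly_Mapping.keys h. pscale (Poly_Mapping.lookup h b) (R b))"
    have "r \<in> std_span lt I"
      unfolding r_def using R(1)
      by (intro poly_vs.subspace_sum subspace_std_span poly_vs.subspace_scale)
    moreover have "lt e a" if e: "e \<in> Poly_Mapping.keys r" for e
    proof -
      obtain b where "b \<in> Poly_Mapping.keys h" "e \<in> Poly_Mapping.keys (R b)"
        using e keys_sum[of "\<lambda>b. pscale (Poly_Mapping.lookup h b) (R b)" "Poly_Mapping.keys h"]
          keys_pscale unfolding r_def by blast
      then show ?thesis
        using R(2) h_keys monomial_order_trans[OF lt] by blast
    qed
    moreover have "Poly_Mapping.single a 1 - r \<in> I"
    proof -
      have "h = (\<Sum>b\<in>Poly_Mapping.keys h.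
          pscale (Poly_Mapping.lookup h b) (Poly_Mapping.single b 1))"
        by (simp add: pscale_single poly_mapping_sum_single)
      then have "h - r = (\<Sum>b\<in>Poly_Mapping.keys h.
          pscale (Poly_Mapping.lookup h b) (Poly_Mapping.single b 1 - R b))"
        by (simp add: r_def poly_vs.scale_right_diff_distrib sum_subtractf)
      also have "\<dots> \<in> I"
        using R(3) by (intro ring_ideal.subspace_sum I ideal_pscale) auto
      finally have "pscale (inverse c) f + (h - r) \<in> I"
        by (intro ring_ideal.subspace_add I ideal_pscale f(1))
      then show ?thesis
        by (simp add: h_def)
    qed
    ultimately show ?thesis by blast
  qed
qed

text \<open>Being graded is what keeps the remainder in the given degree: a smaller monomial never has a
  larger degree.\<close>
lemma normal_form:
  fixes I :: "('n::finite, 'k::field) mpoly set"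
  assumes lt: "graded_monomial_order lt" and I: "ring_ideal.subspace I"
    and f: "f \<in> polys_le d"
  obtains r where "r \<in> std_span lt I" "r \<in> polys_le d" "f - r \<in> I"
proof -
  obtain R where R: "\<And>b. R b \<in> std_span lt I"
    "\<And>b e. e \<in> Poly_Mapping.keys (R b) \<Longrightarrow> e = b \<or> lt e b"
    "\<And>b. Poly_Mapping.single b 1 - R b \<in> I"
    using monom_normal_form[OF graded_imp_monomial_order[OF lt] I] by metis
  define r where "r = (\<Sum>b\<in>Poly_Mapping.keys f. pscale (Poly_Mapping.lookup f b) (R b))"
  have "R b \<in> polys_le d" if "b \<in> Poly_Mapping.keys f" for b
    using that f R(2) graded_less_deg[OF lt] unfolding polys_le_def
    by (smt (verit, ccfv_threshold) mem_Collect_eq of_nat_le_iff)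
  then have "r \<in> polys_le d"
    unfolding r_def by (intro poly_vs.subspace_sum subspace_polys_le poly_vs.subspace_scale)
  moreover have "r \<in> std_span lt I"
    unfolding r_def using R(1)
    by (intro poly_vs.subspace_sum subspace_std_span poly_vs.subspace_scale)
  moreover have "f - r \<in> I"
  proof -
    have "f = (\<Sum>b\<in>Poly_Mapping.keys f.
        pscale (Poly_Mapping.lookup f b) (Poly_Mapping.single b 1))"
      by (simp add: pscale_single poly_mapping_sum_single)
    then have "f - r = (\<Sum>b\<in>Poly_Mapping.keys f.
        pscale (Poly_Mapping.lookup f b) (Poly_Mapping.single b 1 - R b))"
      by (simp add: r_def poly_vs.scale_right_diff_distrib sum_subtractf)
    also have "\<dots> \<in> I"
      using R(3) by (intro ring_ideal.subspace_sum I ideal_pscale) auto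
    finally show ?thesis .
  qed
  ultimately show ?thesis using that by blast
qed

section \<open>Linear codes\<close>

lemma subspace_dual_code: "vec.subspace (dual_code C)"
proof (rule vec.subspaceI)
  fix c v assume "v \<in> dual_code C"
  moreover have "(\<Sum>i\<in>UNIV. (c *s v) $ i * x $ i) = c * (\<Sum>i\<in>UNIV. v $ i * x $ i)" for x
    by (simp add: sum_distrib_left mult.assoc)
  ultimately show "c *s v \<in> dual_code C"
    by (simp add: dual_code_def)
qed (simp_all add: dual_code_def distrib_right sum.distrib)

lemma dual_code_span:
  assumes "B \<subseteq> C" "C \<subseteq> vec.span B"
  shows "dual_code C = {v. \<forall>b\<in>B. (\<Sum>i\<in>UNIV. v $ i * b $ i) = 0}"
proof
  show "dual_code C \<subseteq> {v. \<forall>b\<in>B. (\<Sum>i\<in>UNIV. v $ i * b $ i) = 0}"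
    using assms(1) by (auto simp: dual_code_def)
  show "{v. \<forall>b\<in>B. (\<Sum>i\<in>UNIV. v $ i * b $ i) = 0} \<subseteq> dual_code C"
  proof
    fix v assume v: "v \<in> {v. \<forall>b\<in>B. (\<Sum>i\<in>UNIV. v $ i * b $ i) = 0}"
    have "vec.subspace {x. (\<Sum>i\<in>UNIV. v $ i * x $ i) = 0}"
    proof (rule vec.subspaceI)
      fix c x assume "x \<in> {x. (\<Sum>i\<in>UNIV. v $ i * x $ i) = 0}"
      moreover have "(\<Sum>i\<in>UNIV. v $ i * (c *s x) $ i) = c * (\<Sum>i\<in>UNIV. v $ i * x $ i)"
        unfolding sum_distrib_left vector_smult_component
        by (intro sum.cong refl) (simp only: mult.left_commute)
      ultimately show "c *s x \<in> {x. (\<Sum>i\<in>UNIV. v $ i * x $ i) = 0}"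
        by simp
    qed (simp_all add: distrib_left sum.distrib)
    then have "vec.span B \<subseteq> {x. (\<Sum>i\<in>UNIV. v $ i * x $ i) = 0}"
      using v by (intro vec.span_minimal) auto
    then show "v \<in> dual_code C"
      using assms(2) by (auto simp: dual_code_def)
  qed
qed

text \<open>Extend a basis of \<open>C\<close> to a basis \<open>(h\<^sub>j)\<close> of the whole space. Pairing with all \<open>h\<^sub>j\<close> is an
  automorphism, which turns the dual of \<open>C\<close> into the coordinate subspace where the entries
  belonging to the basis of \<open>C\<close> vanish. This works over every field, where \<open>C\<close> and its dual may
  intersect.\<close>
lemma dim_dual_code:
  fixes C :: "('k::field ^ 'm::finite) set"
  assumes "vec.subspace C"
  shows "vec.dim (dual_code C) + vec.dim C = CARD('m)"
proof -
  obtain B where B: "B \<subseteq> C" "vec.independent B" "C \<subseteq> vec.span B" "card B = vec.dim C"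
    using vec.basis_exists by blast
  define B' where "B' = vec.extend_basis B"
  have B': "B \<subseteq> B'" "vec.independent B'" "vec.span B' = UNIV"
    using B(2) by (simp_all add: B'_def vec.extend_basis_superset vec.independent_extend_basis)
  have "finite B'" "card B' = CARD('m)"
    using B' vec.finiteI_independent[OF B'(2)] vec.dim_span_eq_card_independent[OF B'(2)]
    by (simp_all add: card_cart_basis)
  then have "\<exists>h :: 'm \<Rightarrow> 'k ^ 'm. bij_betw h UNIV B'"
    by (intro finite_same_card_bij) simp_all
  then obtain h :: "'m \<Rightarrow> 'k ^ 'm" where h: "bij_betw h UNIV B'" ..
  define T where "T v = (\<chi> j. \<Sum>i\<in>UNIV. v $ i * h j $ i)" for v :: "'k ^ 'm"
  have T: "Vector_Spaces.linear (*s) (*s) T"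
  proof unfold_locales
    show "T (x + y) = T x + T y" for x y
      by (simp add: T_def vec_eq_iff distrib_right sum.distrib)
    show "T (c *s x) = c *s T x" for c x
      by (simp add: T_def vec_eq_iff sum_distrib_left mult.assoc)
  qed
  have ker: "v = 0" if "T v = 0" for v
  proof -
    have "(\<Sum>i\<in>UNIV. v $ i * b $ i) = 0" if b: "b \<in> B'" for b
    proof -
      obtain j where "b = h j"
        using h b by (auto simp: bij_betw_def)
      then show ?thesis
        using \<open>T v = 0\<close> by (simp add: T_def vec_eq_iff)
    qed
    then have "v \<in> dual_code UNIV"
      using dual_code_span[of B' UNIV] B'(3) by auto
    then have "(\<Sum>i\<in>UNIV. v $ i * axis j 1 $ i) = 0" for j
      by (simp add: dual_code_def)
    then show "v = 0"
      by (simp add: vec_eq_iff axis_def if_distrib cong: if_cong)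
  qed
  then have inj: "inj T"
    using vec.linear_inj_iff_eq_0[OF T] by blast
  then have surj: "surj T"
    by (rule vec.linear_injective_imp_surjective[OF T _ refl])
  define J where "J = {j. h j \<in> B}"
  have "card J = card B"
    by (rule bij_betw_same_card[of h], rule bij_betw_subset[OF h])
      (use B'(1) h in \<open>auto simp: J_def bij_betw_def\<close>)
  have dual: "v \<in> dual_code C \<longleftrightarrow> (\<forall>j\<in>J. T v $ j = 0)" for v
  proof -
    have "B = h ` J"
      using B'(1) h by (auto simp: J_def bij_betw_def)
    then show ?thesis
      by (auto simp: dual_code_span[OF B(1,3)] T_def)
  qed
  have "T ` dual_code C = {w :: 'k ^ 'm. \<forall>j. j \<notin> - J \<longrightarrow> w $ j = 0}"
  proof
    show "T ` dual_code C \<subseteq> {w :: 'k ^ 'm. \<forall>j. j \<notin> - J \<longrightarrow> w $ j = 0}"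
      using dual by auto
    show "{w :: 'k ^ 'm. \<forall>j. j \<notin> - J \<longrightarrow> w $ j = 0} \<subseteq> T ` dual_code C"
    proof
      fix w assume w: "w \<in> {w :: 'k ^ 'm. \<forall>j. j \<notin> - J \<longrightarrow> w $ j = 0}"
      obtain v where "w = T v"
        using surj by blast
      then show "w \<in> T ` dual_code C"
        using w dual by auto
    qed
  qed
  then have "vec.dim (T ` dual_code C) = card (- J)"
    by (simp only: dim_substandard_cart)
  moreover have "vec.dim (T ` dual_code C) = vec.dim (dual_code C)"
    by (rule vec.dim_image_eq[OF T inj_on_subset[OF inj subset_UNIV]])
  moreover have "card (- J) + card J = CARD('m)"
    using card_Diff_subset[of J UNIV] card_mono[of UNIV J] by (simp add: Compl_eq_Diff_UNIV)
  ultimately show ?thesis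
    using \<open>card J = card B\<close> B(4) by simp
qed

lemma linear_scale_code:
  fixes \<beta> :: "'k::field ^ 'm::finite"
  shows "Vector_Spaces.linear (*s) (*s) (\<lambda>c. \<chi> i. \<beta> $ i * c $ i)"
  by unfold_locales (simp_all add: vec_eq_iff distrib_left mult.left_commute)

lemma dim_scale_code:
  assumes "\<forall>i. \<beta> $ i \<noteq> 0"
  shows "vec.dim (scale_code \<beta> C) = vec.dim C"
proof -
  have "inj (\<lambda>c. \<chi> i. \<beta> $ i * c $ i)"
    using assms by (auto simp: inj_on_def vec_eq_iff)
  from inj_on_subset[OF this subset_UNIV] show ?thesis
    unfolding scale_code_def by (rule vec.dim_image_eq[OF linear_scale_code])
qed

lemma subspace_scale_code:
  assumes "vec.subspace C"
  shows "vec.subspace (scale_code \<beta> C)"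
  unfolding scale_code_def by (rule vec.linear_subspace_image[OF linear_scale_code assms])

lemma subspace_RM_code: "vec.subspace (RM_code P d)"
proof -
  interpret E: Vector_Spaces.linear pscale "(*s)" "eval_vec P"
    by (rule linear_eval_vec)
  show ?thesis
    unfolding RM_code_eq_image by (rule E.subspace_image[OF subspace_polys_le])
qed

lemma RM_code_mono: "d \<le> e \<Longrightarrow> RM_code P d \<subseteq> RM_code P e"
  unfolding RM_code_eq_image by (intro image_mono polys_le_mono)

lemma polys_le_negative: "d < 0 \<Longrightarrow> polys_le d = {0}"
proof -
  assume "d < 0"
  then have "f \<in> polys_le d \<longleftrightarrow> Poly_Mapping.keys f = {}" for f :: "('n::finite, 'k::field) mpoly"
    by (auto simp: polys_le_def)
  then show ?thesis by auto
qed

lemma axis_notin_RM_code_negative: "d < 0 \<Longrightarrow> axis i 1 \<notin> RM_code P d"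
  by (simp add: RM_code_eq_image polys_le_negative vec_eq_iff axis_def)

lemma RM_code_0:
  fixes P :: "'m::finite \<Rightarrow> 'k::field ^ 'n::finite"
  shows "RM_code P 0 = vec.span {\<chi> i. 1}"
proof -
  have "\<exists>c. f = Poly_Mapping.single 0 c" if "f \<in> polys_le 0" for f :: "('n, 'k) mpoly"
  proof -
    have "a = 0" if "a \<in> Poly_Mapping.keys f" for a
    proof (rule poly_mapping_eqI)
      fix i
      have "monom_deg a = 0"
        using that \<open>f \<in> polys_le 0\<close> by (auto simp: polys_le_def)
      then show "Poly_Mapping.lookup a i = Poly_Mapping.lookup 0 i"
        by (simp add: monom_deg_def)
    qed
    then have "Poly_Mapping.keys f \<subseteq> {0}"
      by auto
    from poly_mapping_sum_single_superset[OF _ this]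
    have "f = Poly_Mapping.single 0 (Poly_Mapping.lookup f 0)"
      by simp
    then show ?thesis by blast
  qed
  moreover have "Poly_Mapping.single 0 c \<in> polys_le 0" for c :: 'k
    by (simp add: polys_le_def monom_deg_def)
  ultimately have "polys_le 0 = range (Poly_Mapping.single (0 :: 'n monom) :: 'k \<Rightarrow> _)"
    by blast
  then show ?thesis
    by (simp add: RM_code_eq_image vec.span_singleton image_image eval_vec_def poly_eval_single
        vector_scalar_mult_def)
qed

lemma dim_RM_code_0:
  fixes P :: "'m::finite \<Rightarrow> 'k::field ^ 'n::finite"
  shows "vec.dim (RM_code P 0) = 1"
proof -
  have "(\<chi> i. 1) \<noteq> (0 :: 'k ^ 'm)"
    by (simp add: vec_eq_iff)
  then show ?thesis
    by (simp only: RM_code_0 vec.dim_span vec.dim_singleton if_False)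
qed

section \<open>Vanishing ideals of finite sets of points\<close>

lemma subspace_vanishing_ideal: "ring_ideal.subspace (vanishing_ideal X)"
  by (auto simp: ring_ideal.subspace_def vanishing_ideal_def poly_eval_add poly_eval_mult)

lemma vanishing_ideal_range_iff: "f \<in> vanishing_ideal (range P) \<longleftrightarrow> eval_vec P f = 0"
  by (simp add: vanishing_ideal_def vec_eq_iff)

text \<open>The product over \<open>j \<noteq> i\<close> of affine linear polynomials, each separating the \<open>i\<close>-th point from the
  \<open>j\<close>-th one by a coordinate in which they differ.\<close>
lemma indicator_poly:
  fixes P :: "'m::finite \<Rightarrow> 'k::field ^ 'n::finite"
  assumes "inj P"
  obtains f where "eval_vec P f = axis i 1"
proof -
  have "\<exists>g. poly_eval g (P i) = 1 \<and> poly_eval g (P j) = 0" if ij: "i \<noteq> j" for j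
  proof -
    obtain k where k: "P i $ k \<noteq> P j $ k"
      using assms ij by (auto simp: inj_def vec_eq_iff)
    define t :: "('n, 'k) mpoly" where "t = Poly_Mapping.single (Poly_Mapping.single k 1) 1"
    have t: "poly_eval t x = x $ k" for x
    proof -
      have "(\<Prod>i\<in>UNIV. (x $ i) ^ Poly_Mapping.lookup (Poly_Mapping.single k 1) i) =
          (\<Prod>i\<in>UNIV. if i = k then x $ i else 1)"
        by (intro prod.cong) (auto simp: lookup_single when_def)
      then show ?thesis
        by (simp add: t_def poly_eval_single)
    qed
    define g where "g = pscale (inverse (P i $ k - P j $ k)) (t - Poly_Mapping.single 0 (P j $ k))"
    have "poly_eval g (P i) = 1 \<and> poly_eval g (P j) = 0"
      using k by (simp add: g_def poly_eval_diff poly_eval_single t)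
    then show ?thesis by blast
  qed
  then obtain G where G: "\<And>j. i \<noteq> j \<Longrightarrow> poly_eval (G j) (P i) = 1 \<and> poly_eval (G j) (P j) = 0"
    by metis
  have "poly_eval (\<Prod>j\<in>- {i}. G j) (P l) = axis i 1 $ l" for l
  proof (cases "l = i")
    case True
    have "poly_eval (\<Prod>j\<in>- {i}. G j) (P i) = (\<Prod>j\<in>- {i}. 1)"
      unfolding poly_eval_prod by (intro prod.cong) (use G in auto)
    then show ?thesis using True by simp
  next
    case False
    then have "poly_eval (G l) (P l) = 0" using G[of l] by auto
    then have "(\<Prod>j\<in>- {i}. poly_eval (G j) (P l)) = 0"
      using False by (intro prod_zero) auto
    then show ?thesis using False by (simp add: poly_eval_prod axis_def)
  qed
  then show ?thesis
    by (intro that[of "\<Prod>j\<in>- {i}. G j"]) (simp add: vec_eq_iff)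
qed

lemma ex_RM_code_eq_UNIV:
  fixes P :: "'m::finite \<Rightarrow> 'k::field ^ 'n::finite"
  assumes "inj P"
  shows "\<exists>d::nat. RM_code P (int d) = UNIV"
proof -
  have "\<exists>d::nat. axis i 1 \<in> RM_code P (int d)" for i
  proof -
    obtain f where "eval_vec P f = axis i 1"
      using indicator_poly[OF assms] .
    moreover obtain d :: nat where "f \<in> polys_le (int d)"
      using ex_polys_le[of f] by blast
    ultimately have "axis i 1 \<in> RM_code P (int d)"
      unfolding RM_code_eq_image by (intro image_eqI[of _ _ f]) simp_all
    then show ?thesis ..
  qed
  then obtain D where D: "\<And>i. axis i 1 \<in> RM_code P (int (D i))"
    by metis
  define d where "d = (\<Sum>i\<in>UNIV. D i)"
  have axis_mem: "axis i 1 \<in> RM_code P (int d)" for i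
  proof -
    have "D i \<le> d"
      unfolding d_def by (rule member_le_sum) auto
    then show ?thesis
      using D[of i] RM_code_mono[of "int (D i)" "int d" P] by auto
  qed
  have "v \<in> RM_code P (int d)" for v
  proof -
    have "v = (\<Sum>i\<in>UNIV. v $ i *s axis i 1)"
      by (simp add: basis_expansion)
    also have "\<dots> \<in> RM_code P (int d)"
      by (intro vec.subspace_sum subspace_RM_code vec.subspace_scale axis_mem)
    finally show ?thesis .
  qed
  then have "RM_code P (int d) = UNIV"
    by (rule UNIV_eq_I[symmetric])
  then show ?thesis ..
qed

section \<open>The affine Hilbert function as a dimension and as a number of monomials\<close>

lemma eval_normal_form:
  assumes "graded_monomial_order lt" "f \<in> polys_le d"
  obtains r where "r \<in> std_span lt (vanishing_ideal (range P))" "r \<in> polys_le d"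
    "eval_vec P r = eval_vec P f"
proof -
  interpret E: Vector_Spaces.linear pscale "(*s)" "eval_vec P"
    by (rule linear_eval_vec)
  obtain r where r: "r \<in> std_span lt (vanishing_ideal (range P))" "r \<in> polys_le d"
    "f - r \<in> vanishing_ideal (range P)"
    using normal_form[OF assms(1) subspace_vanishing_ideal assms(2)] by metis
  moreover have "eval_vec P r = eval_vec P f"
    using r(3) by (simp add: vanishing_ideal_range_iff E.diff)
  ultimately show ?thesis using that by metis
qed

lemma std_span_eval_inj:
  assumes "graded_monomial_order lt"
    and "r \<in> std_span lt (vanishing_ideal (range P))"
    and "r' \<in> std_span lt (vanishing_ideal (range P))"
    and "eval_vec P r = eval_vec P r'"
  shows "r = r'"
proof -
  interpret E: Vector_Spaces.linear pscale "(*s)" "eval_vec P"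
    by (rule linear_eval_vec)
  have "r - r' \<in> std_span lt (vanishing_ideal (range P))"
    using assms(2,3) by (intro poly_vs.subspace_diff subspace_std_span)
  moreover have "r - r' \<in> vanishing_ideal (range P)"
    using assms(4) by (simp add: vanishing_ideal_range_iff E.diff)
  ultimately have "r - r' = 0"
    by (rule std_span_Int_ideal[OF graded_imp_monomial_order[OF assms(1)]])
  then show ?thesis by simp
qed

text \<open>Evaluation embeds \<open>V / (I \<inter> V)\<close> into \<open>K\<^sup>m\<close>, so it carries every quotient basis to a basis of the
  image. In particular all quotient bases have the same size, as the definition of the quotient
  dimension by a definite description requires.\<close>
lemma card_quotient_basis:
  fixes P :: "'m::finite \<Rightarrow> 'k::field ^ 'n::finite"
  assumes V: "poly_vs.subspace V"
    and B: "quotient_basis V (vanishing_ideal (range P) \<inter> V) B"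
  shows "card B = vec.dim (eval_vec P ` V)"
proof -
  interpret E: Vector_Spaces.linear pscale "(*s)" "eval_vec P"
    by (rule linear_eval_vec)
  let ?E = "eval_vec P" and ?W = "vanishing_ideal (range P) \<inter> V"
  have fin: "finite B" and sub: "B \<subseteq> V"
    using B by (simp_all add: quotient_basis_def)
  have ex: "\<exists>!c. (\<forall>b. b \<notin> B \<longrightarrow> c b = 0) \<and> v - (\<Sum>b\<in>B. pscale (c b) b) \<in> ?W" if "v \<in> V" for v
    using B that by (simp add: quotient_basis_def)
  have comb: "(\<Sum>b\<in>B. pscale (c b) b) \<in> V" for c
    using sub by (intro poly_vs.subspace_sum V poly_vs.subspace_scale) auto
  have in_W: "v - (\<Sum>b\<in>B. pscale (c b) b) \<in> ?W \<longleftrightarrow> ?E v = (\<Sum>b\<in>B. c b *s ?E b)"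
    if "v \<in> V" for v c
    using poly_vs.subspace_diff[OF V that comb]
    by (simp add: vanishing_ideal_range_iff E.diff E.sum E.scale)
  have uniq: "c = c'"
    if "v \<in> V" "\<forall>b. b \<notin> B \<longrightarrow> c b = 0" "?E v = (\<Sum>b\<in>B. c b *s ?E b)"
      "\<forall>b. b \<notin> B \<longrightarrow> c' b = 0" "?E v = (\<Sum>b\<in>B. c' b *s ?E b)" for v c c'
  proof -
    let ?Q = "\<lambda>c. (\<forall>b. b \<notin> B \<longrightarrow> c b = 0) \<and> v - (\<Sum>b\<in>B. pscale (c b) b) \<in> ?W"
    have "?Q c" "?Q c'"
      using in_W[OF that(1), of c] in_W[OF that(1), of c'] that(2-5) by (simp_all only:)
    then show ?thesis
      using the1_equality[OF ex[OF that(1)], of c] the1_equality[OF ex[OF that(1)], of c'] by simp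
  qed
  have inj: "inj_on ?E B"
  proof (rule inj_onI)
    fix b b' assume b: "b \<in> B" "b' \<in> B" "?E b = ?E b'"
    \<comment> \<open>If \<open>b\<close> and \<open>b'\<close> have the same values, both unit coefficient families represent \<open>b\<close>.\<close>
    let ?\<delta> = "\<lambda>b x. if x = b then 1 else 0 :: 'k"
    have \<delta>: "(\<Sum>x\<in>B. ?\<delta> b x *s ?E x) = ?E b" if "b \<in> B" for b
    proof -
      have "(\<Sum>x\<in>B. ?\<delta> b x *s ?E x) = (\<Sum>x\<in>B. if x = b then ?E x else 0)"
        by (intro sum.cong) auto
      then show ?thesis using fin that by simp
    qed
    have "b \<in> V" using b(1) sub by blast
    have "?\<delta> b = ?\<delta> b'"
      by (rule uniq[OF \<open>b \<in> V\<close>]) (use \<delta>[OF b(1)] \<delta>[OF b(2)] b in auto)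
    from fun_cong[OF this, of b] show "b = b'"
      by (simp split: if_splits)
  qed
  have "vec.independent (?E ` B)"
  proof (rule vec.independent_if_scalars_zero)
    fix u y assume u: "(\<Sum>x\<in>?E ` B. u x *s x) = 0" and "y \<in> ?E ` B"
    then obtain b where b: "b \<in> B" "y = ?E b" by blast
    define c where "c b = (if b \<in> B then u (?E b) else 0)" for b
    have "?E 0 = (\<Sum>b\<in>B. c b *s ?E b)"
      using u by (simp add: sum.reindex[OF inj] c_def E.zero)
    moreover have "?E 0 = (\<Sum>b\<in>B. 0 *s ?E b)"
      by (simp add: E.zero)
    moreover have "0 \<in> V"
      by (rule poly_vs.subspace_0[OF V])
    ultimately have "c = (\<lambda>b. 0)"
      by (intro uniq[of 0]) (simp_all add: c_def)
    from fun_cong[OF this, of b] show "u y = 0"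
      using b by (simp add: c_def)
  qed (simp add: fin)
  moreover have "?E ` V \<subseteq> vec.span (?E ` B)"
  proof
    fix y assume "y \<in> ?E ` V"
    then obtain v where v: "v \<in> V" "y = ?E v" by blast
    obtain c where "v - (\<Sum>b\<in>B. pscale (c b) b) \<in> ?W"
      using ex[OF v(1)] by auto
    then have "y = (\<Sum>b\<in>B. c b *s ?E b)"
      using in_W[OF v(1)] v(2) by simp
    also have "\<dots> \<in> vec.span (?E ` B)"
      by (intro vec.span_sum vec.span_scale vec.span_base imageI)
    finally show "y \<in> vec.span (?E ` B)" .
  qed
  ultimately have "card (?E ` B) = vec.dim (?E ` V)"
    using sub by (intro vec.basis_card_eq_dim) auto
  then show ?thesis
    by (simp add: card_image[OF inj])
qed

lemma finite_monoms_deg_le: "finite {a :: 'n::finite monom. int (monom_deg a) \<le> d}"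
proof -
  let ?A = "{a :: 'n monom. int (monom_deg a) \<le> d}"
  have "Poly_Mapping.lookup a i \<in> {..nat d}" if "a \<in> ?A" for a :: "'n monom" and i
  proof -
    have "Poly_Mapping.lookup a i \<le> monom_deg a"
      unfolding monom_deg_def by (rule member_le_sum) auto
    then show ?thesis using that by auto
  qed
  then have "Poly_Mapping.lookup ` ?A \<subseteq> Pi\<^sub>E UNIV (\<lambda>_. {..nat d})"
    by (auto simp: PiE_def)
  then have "finite (Poly_Mapping.lookup ` ?A)"
    by (rule finite_subset) (simp add: finite_PiE)
  then show ?thesis
    by (rule finite_imageD) (simp add: inj_on_def)
qed

lemma single_one_inject:
  "Poly_Mapping.single a (1::'k::zero_neq_one) = Poly_Mapping.single b 1 \<longleftrightarrow> a = b"
proof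
  assume "Poly_Mapping.single a (1::'k) = Poly_Mapping.single b 1"
  then have "Poly_Mapping.keys (Poly_Mapping.single a (1::'k)) =
      Poly_Mapping.keys (Poly_Mapping.single b (1::'k))"
    by (rule arg_cong)
  then show "a = b" by simp
qed simp

text \<open>Existence of the coefficients is the degree-preserving normal form; they are unique because
  evaluation is injective on the span of the standard monomials.\<close>
lemma quotient_basis_std_monoms:
  fixes P :: "'m::finite \<Rightarrow> 'k::field ^ 'n::finite"
  assumes lt: "graded_monomial_order lt"
  defines "I \<equiv> vanishing_ideal (range P)"
  shows "quotient_basis (polys_le d) (I \<inter> polys_le d)
    ((\<lambda>a. Poly_Mapping.single a 1) ` {a \<in> std_monoms lt I. int (monom_deg a) \<le> d})"
proof -
  interpret E: Vector_Spaces.linear pscale "(*s)" "eval_vec P"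
    by (rule linear_eval_vec)
  let ?s = "\<lambda>a. Poly_Mapping.single a (1::'k)"
  define A where "A = {a \<in> std_monoms lt I. int (monom_deg a) \<le> d}"
  define comb where "comb c = (\<Sum>a\<in>A. Poly_Mapping.single a (c (?s a)))"
    for c :: "('n, 'k) mpoly \<Rightarrow> 'k"
  have finA: "finite A"
    unfolding A_def by (rule finite_subset[OF _ finite_monoms_deg_le[of d]]) auto
  have inj: "inj ?s"
    by (rule injI) (simp add: single_one_inject)
  have comb: "(\<Sum>b\<in>?s ` A. pscale (c b) b) = comb c" for c
    by (simp add: comb_def sum.reindex[OF inj_on_subset[OF inj subset_UNIV]] pscale_single)
  have lookup_comb: "Poly_Mapping.lookup (comb c) a = c (?s a)" if "a \<in> A" for c a
  proof -
    have "Poly_Mapping.lookup (comb c) a = (\<Sum>e\<in>A. if a = e then c (?s e) else 0)"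
      unfolding comb_def lookup_sum by (intro sum.cong) (auto simp: lookup_single when_def)
    then show ?thesis using finA that by simp
  qed
  have keys_comb: "Poly_Mapping.keys (comb c) \<subseteq> A" for c
  proof -
    have "Poly_Mapping.keys (comb c) \<subseteq> (\<Union>a\<in>A. Poly_Mapping.keys (Poly_Mapping.single a (c (?s a))))"
      unfolding comb_def by (rule keys_sum)
    also have "\<dots> \<subseteq> A"
      by (auto split: if_splits)
    finally show ?thesis .
  qed
  have "\<exists>!c. (\<forall>b. b \<notin> ?s ` A \<longrightarrow> c b = 0) \<and> v - comb c \<in> I \<inter> polys_le d"
    if v: "v \<in> polys_le d" for v
  proof -
    obtain r where r: "r \<in> std_span lt I" "r \<in> polys_le d" "eval_vec P r = eval_vec P v"
      unfolding I_def using eval_normal_form[OF lt v] by metis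
    have keys_r: "Poly_Mapping.keys r \<subseteq> A"
      using r(1,2) by (auto simp: std_span_eq polys_le_def A_def)
    show ?thesis
    proof (rule ex1I)
      let ?c = "\<lambda>b. if b \<in> ?s ` A then Poly_Mapping.lookup r (inv ?s b) else 0"
      have "comb ?c = (\<Sum>a\<in>A. Poly_Mapping.single a (Poly_Mapping.lookup r a))"
        unfolding comb_def by (intro sum.cong) (auto simp: inv_f_f[OF inj])
      then have "comb ?c = r"
        using poly_mapping_sum_single_superset[OF finA keys_r] by simp
      moreover have "v - r \<in> I \<inter> polys_le d"
        using r(3) poly_vs.subspace_diff[OF subspace_polys_le v r(2)]
        by (simp add: I_def vanishing_ideal_range_iff E.diff)
      ultimately show "(\<forall>b. b \<notin> ?s ` A \<longrightarrow> ?c b = 0) \<and> v - comb ?c \<in> I \<inter> polys_le d"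
        by simp
      fix c assume c: "(\<forall>b. b \<notin> ?s ` A \<longrightarrow> c b = 0) \<and> v - comb c \<in> I \<inter> polys_le d"
      have "comb c \<in> std_span lt I"
        using keys_comb[of c] by (auto simp: std_span_eq A_def)
      moreover have "eval_vec P (comb c) = eval_vec P r"
        using c r(3) by (simp add: I_def vanishing_ideal_range_iff E.diff)
      ultimately have "comb c = r"
        using r(1) unfolding I_def by (intro std_span_eval_inj[OF lt])
      then show "c = ?c"
        using c lookup_comb[of _ c] by (auto simp: inv_f_f[OF inj] fun_eq_iff)
    qed
  qed
  moreover have "?s ` A \<subseteq> polys_le d"
    by (auto simp: A_def polys_le_def)
  ultimately show ?thesis
    unfolding quotient_basis_def A_def[symmetric] comb using finA by simp
qed

lemma
  fixes P :: "'m::finite \<Rightarrow> 'k::field ^ 'n::finite" and lt :: "'n monom \<Rightarrow> 'n monom \<Rightarrow> bool"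
  assumes lt: "graded_monomial_order lt"
  shows affine_hilbert_eq_dim:
      "affine_hilbert (vanishing_ideal (range P)) d = vec.dim (RM_code P d)"
    and dim_eq_card_std_monoms:
      "vec.dim (RM_code P d) =
        card {a \<in> std_monoms lt (vanishing_ideal (range P)). int (monom_deg a) \<le> d}"
proof -
  let ?A = "{a \<in> std_monoms lt (vanishing_ideal (range P)). int (monom_deg a) \<le> d}"
  let ?B = "(\<lambda>a. Poly_Mapping.single a (1::'k)) ` ?A"
  let ?q = "quotient_basis (polys_le d) (vanishing_ideal (range P) \<inter> polys_le d)"
  have ex: "?q ?B"
    by (rule quotient_basis_std_monoms[OF lt])
  have card: "card B = vec.dim (RM_code P d)" if "?q B" for B
    using card_quotient_basis[OF subspace_polys_le that] by (simp add: RM_code_eq_image)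
  show "affine_hilbert (vanishing_ideal (range P)) d = vec.dim (RM_code P d)"
    unfolding affine_hilbert_def quotient_dim_def
  proof (rule the_equality)
    show "\<exists>B. ?q B \<and> card B = vec.dim (RM_code P d)"
      using ex card by blast
    show "n = vec.dim (RM_code P d)" if "\<exists>B. ?q B \<and> card B = n" for n
      using that card by blast
  qed
  have "inj (\<lambda>a :: 'n monom. Poly_Mapping.single a (1::'k))"
    by (rule injI) (simp add: single_one_inject)
  from inj_on_subset[OF this subset_UNIV] have "card ?B = card ?A"
    by (rule card_image)
  then show "vec.dim (RM_code P d) = card ?A"
    using card[OF ex] by simp
qed

text \<open>The defining set of the regularity index is nonempty because some degree suffices for all
  indicator polynomials; hence the index itself belongs to it.\<close>
lemma RM_code_reg_index:
  fixes P :: "'m::finite \<Rightarrow> 'k::field ^ 'n::finite" and lt :: "'n monom \<Rightarrow> 'n monom \<Rightarrow> bool"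
  assumes "inj P" "graded_monomial_order lt"
  shows "RM_code P (int (reg_index (affine_hilbert (vanishing_ideal (range P))) CARD('m))) = UNIV"
proof -
  let ?H = "affine_hilbert (vanishing_ideal (range P))"
  have H: "?H d = CARD('m) \<longleftrightarrow> RM_code P d = UNIV" for d
    unfolding affine_hilbert_eq_dim[OF assms(2)]
    using vec.dim_eq_full[of "RM_code P d"] vec.span_eq_iff[THEN iffD2, OF subspace_RM_code[of P d]]
    by (simp add: card_cart_basis vec.dimension_def)
  obtain l :: nat where "RM_code P (int l) = UNIV"
    using ex_RM_code_eq_UNIV[OF assms(1)] by blast
  then have "\<forall>d\<ge>int l. ?H d = CARD('m)"
    using RM_code_mono[of "int l" _ P] by (auto simp: H)
  then have "\<forall>d\<ge>int (reg_index ?H CARD('m)). ?H d = CARD('m)"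
    unfolding reg_index_def by (rule LeastI)
  then show ?thesis
    using H by simp
qed

section \<open>Colon ideals, associated primes and v-numbers\<close>

text \<open>The colon ideal consists of the polynomials vanishing on the support of \<open>f\<close>, that is, at all
  points where \<open>f\<close> does not vanish. It determines the support, since an indicator polynomial of a
  point in the support is not in it but vanishes at all other points.\<close>
lemma colon_vanishing_ideal_eq_point_iff:
  fixes P :: "'m::finite \<Rightarrow> 'k::field ^ 'n::finite"
  assumes "inj P"
  shows "colon_ideal (vanishing_ideal (range P)) f = vanishing_ideal {P i} \<longleftrightarrow>
    poly_eval f (P i) \<noteq> 0 \<and> (\<forall>j. j \<noteq> i \<longrightarrow> poly_eval f (P j) = 0)"
    (is "?colon = ?p \<longleftrightarrow> ?supp")
proof
  have mem: "g \<in> ?colon \<longleftrightarrow> (\<forall>j. poly_eval g (P j) = 0 \<or> poly_eval f (P j) = 0)" for g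
    by (simp add: colon_ideal_def vanishing_ideal_def poly_eval_mult)
  show "?colon = ?p" if ?supp
  proof (rule set_eqI)
    fix g
    have "g \<in> ?p \<longleftrightarrow> poly_eval g (P i) = 0"
      by (simp add: vanishing_ideal_def)
    then show "g \<in> ?colon \<longleftrightarrow> g \<in> ?p"
      using that mem[of g] by metis
  qed
  assume eq: "?colon = ?p"
  have "1 \<notin> ?p"
    by (simp add: vanishing_ideal_def)
  then obtain k where k: "poly_eval f (P k) \<noteq> 0"
    using eq mem[of 1] by auto
  have only: "j = i" if j: "poly_eval f (P j) \<noteq> 0" for j
  proof (rule ccontr)
    assume "j \<noteq> i"
    obtain h where h: "eval_vec P h = axis j 1"
      using indicator_poly[OF assms] .
    then have "poly_eval h (P j) = 1" "poly_eval h (P i) = 0"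
      using \<open>j \<noteq> i\<close> by (simp_all add: vec_eq_iff axis_def)
    moreover have "h \<in> ?colon"
      unfolding eq using \<open>poly_eval h (P i) = 0\<close> by (simp add: vanishing_ideal_def)
    then have "poly_eval h (P j) = 0 \<or> poly_eval f (P j) = 0"
      unfolding mem by blast
    ultimately show False
      using j by simp
  qed
  show ?supp
    using k only by metis
qed

lemma prime_point_ideal:
  fixes x :: "'k::field ^ 'n::finite"
  shows "prime_ideal (vanishing_ideal {x})"
proof -
  have "1 \<notin> vanishing_ideal {x}"
    by (simp add: vanishing_ideal_def)
  then have "vanishing_ideal {x} \<noteq> UNIV"
    by (metis UNIV_I)
  moreover have "a \<in> vanishing_ideal {x} \<or> b \<in> vanishing_ideal {x}"
    if "a * b \<in> vanishing_ideal {x}" for a b :: "('n, 'k) mpoly"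
    using that by (simp add: vanishing_ideal_def poly_eval_mult)
  ultimately show ?thesis
    unfolding prime_ideal_def by (simp add: subspace_vanishing_ideal)
qed

text \<open>A colon ideal whose support has two points contains the product of their indicator polynomials
  but neither factor, so it is not prime.\<close>
lemma assoc_primes_vanishing_ideal:
  fixes P :: "'m::finite \<Rightarrow> 'k::field ^ 'n::finite"
  assumes "inj P"
  shows "assoc_primes (vanishing_ideal (range P)) = range (\<lambda>i. vanishing_ideal {P i})"
proof
  let ?I = "vanishing_ideal (range P)"
  show "range (\<lambda>i. vanishing_ideal {P i}) \<subseteq> assoc_primes ?I"
  proof clarify
    fix i
    obtain h where "eval_vec P h = axis i 1"
      using indicator_poly[OF assms] .
    then have "colon_ideal ?I h = vanishing_ideal {P i}"
      unfolding colon_vanishing_ideal_eq_point_iff[OF assms] by (simp add: vec_eq_iff axis_def)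
    then show "vanishing_ideal {P i} \<in> assoc_primes ?I"
      using prime_point_ideal[of "P i"] unfolding assoc_primes_def by blast
  qed
  show "assoc_primes ?I \<subseteq> range (\<lambda>i. vanishing_ideal {P i})"
  proof
    fix p assume "p \<in> assoc_primes ?I"
    then obtain f where p: "prime_ideal p" "p = colon_ideal ?I f"
      unfolding assoc_primes_def by blast
    have mem: "g \<in> p \<longleftrightarrow> (\<forall>j. poly_eval g (P j) = 0 \<or> poly_eval f (P j) = 0)" for g
      by (simp add: p(2) colon_ideal_def vanishing_ideal_def poly_eval_mult)
    have "p \<noteq> UNIV"
      using p(1) by (simp add: prime_ideal_def)
    then obtain i where i: "poly_eval f (P i) \<noteq> 0"
      using mem by auto
    have "poly_eval f (P j) = 0" if "j \<noteq> i" for j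
    proof (rule ccontr)
      assume j: "poly_eval f (P j) \<noteq> 0"
      obtain g where g: "eval_vec P g = axis i 1"
        using indicator_poly[OF assms] .
      obtain h where h: "eval_vec P h = axis j 1"
        using indicator_poly[OF assms] .
      have gh: "poly_eval g (P l) = axis i 1 $ l" "poly_eval h (P l) = axis j 1 $ l" for l
        using g h by (simp_all add: vec_eq_iff)
      have "g * h \<in> p"
        unfolding mem using \<open>j \<noteq> i\<close> by (simp add: poly_eval_mult gh axis_def)
      then have "g \<in> p \<or> h \<in> p"
        using p(1) by (simp add: prime_ideal_def)
      moreover have "g \<notin> p" "h \<notin> p"
        unfolding mem using i j gh by (metis axis_nth one_neq_zero)+
      ultimately show False by simp
    qed
    then have "p = vanishing_ideal {P i}"
      unfolding p(2) colon_vanishing_ideal_eq_point_iff[OF assms] using i by simp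
    then show "p \<in> range (\<lambda>i. vanishing_ideal {P i})"
      by simp
  qed
qed

text \<open>Up to a scalar, the polynomials competing in the minimum are those that evaluate to the \<open>i\<close>-th
  unit vector.\<close>
lemma v_number_le_iff:
  fixes P :: "'m::finite \<Rightarrow> 'k::field ^ 'n::finite"
  assumes "inj P"
  shows "v_number (vanishing_ideal {P i}) (vanishing_ideal (range P)) \<le> d \<longleftrightarrow>
    axis i 1 \<in> RM_code P (int d)"
proof -
  define Q where "Q e \<longleftrightarrow> (\<exists>f. f \<noteq> 0 \<and> total_deg f = e \<and>
    colon_ideal (vanishing_ideal (range P)) f = vanishing_ideal {P i})" for e
  have v: "v_number (vanishing_ideal {P i}) (vanishing_ideal (range P)) = (LEAST e. Q e)"
    by (simp add: v_number_def Q_def)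
  have ind: "Q (total_deg f)" "f \<noteq> 0" if f: "eval_vec P f = axis i 1" for f
  proof -
    have f': "poly_eval f (P l) = axis i 1 $ l" for l
      using f by (simp add: vec_eq_iff)
    then show "f \<noteq> 0"
      by (metis axis_nth one_neq_zero poly_eval_0)
    moreover have "colon_ideal (vanishing_ideal (range P)) f = vanishing_ideal {P i}"
      unfolding colon_vanishing_ideal_eq_point_iff[OF assms] by (simp add: f' axis_def)
    ultimately show "Q (total_deg f)"
      unfolding Q_def by blast
  qed
  show ?thesis
    unfolding v
  proof
    assume "(LEAST e. Q e) \<le> d"
    moreover obtain h where "eval_vec P h = axis i 1"
      using indicator_poly[OF assms] .
    then have "Q (LEAST e. Q e)"
      using ind(1) by (intro LeastI)
    then obtain f where f: "f \<noteq> 0" "total_deg f = (LEAST e. Q e)"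
      "colon_ideal (vanishing_ideal (range P)) f = vanishing_ideal {P i}"
      unfolding Q_def by blast
    ultimately have "f \<in> polys_le (int d)"
      using total_deg_le_iff[of f "int d"] by simp
    then have "pscale (inverse (poly_eval f (P i))) f \<in> polys_le (int d)"
      by (rule poly_vs.subspace_scale[OF subspace_polys_le])
    moreover have "axis i 1 = eval_vec P (pscale (inverse (poly_eval f (P i))) f)"
      using f(3) unfolding colon_vanishing_ideal_eq_point_iff[OF assms]
      by (simp add: vec_eq_iff axis_def)
    ultimately show "axis i 1 \<in> RM_code P (int d)"
      unfolding RM_code_eq_image by (rule rev_image_eqI)
  next
    assume "axis i 1 \<in> RM_code P (int d)"
    then obtain f where f: "f \<in> polys_le (int d)" "eval_vec P f = axis i 1"
      unfolding RM_code_eq_image by auto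
    have "total_deg f \<le> d"
      using total_deg_le_iff[of f "int d"] ind(2)[OF f(2)] f(1) by simp
    moreover have "(LEAST e. Q e) \<le> total_deg f"
      by (rule Least_le[of Q, OF ind(1)[OF f(2)]])
    ultimately show "(LEAST e. Q e) \<le> d"
      by simp
  qed
qed

lemma v_number_eq_iff:
  fixes P :: "'m::finite \<Rightarrow> 'k::field ^ 'n::finite"
  assumes "inj P" "RM_code P (int r) = UNIV"
  shows "r = v_number (vanishing_ideal {P i}) (vanishing_ideal (range P)) \<longleftrightarrow>
    axis i 1 \<notin> RM_code P (int r - 1)"
proof -
  let ?v = "v_number (vanishing_ideal {P i}) (vanishing_ideal (range P))"
  have "?v \<le> r"
    by (simp add: v_number_le_iff[OF assms(1)] assms(2))
  show ?thesis
  proof (cases r)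
    \<comment> \<open>In degree \<open>-1\<close> the code is zero and contains no unit vector.\<close>
    case 0
    then show ?thesis
      using \<open>?v \<le> r\<close> axis_notin_RM_code_negative[of "-1" i P] by simp
  next
    case (Suc s)
    then show ?thesis
      using \<open>?v \<le> r\<close> v_number_le_iff[OF assms(1), of i s] by auto
  qed
qed

section \<open>Standard indicator functions\<close>

lemma
  fixes P :: "'m::finite \<Rightarrow> 'k::field ^ 'n::finite" and lt :: "'n monom \<Rightarrow> 'n monom \<Rightarrow> bool"
  assumes "inj P" and lt: "graded_monomial_order lt"
  shows std_indicator_in_std_span:
      "std_indicator lt P i \<in> std_span lt (vanishing_ideal (range P))"
    and eval_std_indicator: "eval_vec P (std_indicator lt P i) = axis i 1"
proof -
  obtain h where h: "eval_vec P h = axis i 1"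
    using indicator_poly[OF assms(1)] .
  obtain d :: nat where "h \<in> polys_le (int d)"
    using ex_polys_le[of h] by blast
  then obtain r where r: "r \<in> std_span lt (vanishing_ideal (range P))" "eval_vec P r = axis i 1"
    using eval_normal_form[OF lt, of h "int d" P] h by metis
  have ind: "poly_eval f (P i) = 1 \<and> (\<forall>j. j \<noteq> i \<longrightarrow> poly_eval f (P j) = 0) \<longleftrightarrow>
      eval_vec P f = axis i 1" for f
    by (auto simp: vec_eq_iff axis_def)
  have "std_indicator lt P i = r"
    unfolding std_indicator_def ind
  proof (rule the_equality)
    show "f = r" if "f \<in> std_span lt (vanishing_ideal (range P)) \<and> eval_vec P f = axis i 1" for f
      using that r by (intro std_span_eval_inj[OF lt, of f P r]) simp_all
  qed (use r in simp)
  then show "std_indicator lt P i \<in> std_span lt (vanishing_ideal (range P))"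
    and "eval_vec P (std_indicator lt P i) = axis i 1"
    using r by simp_all
qed

text \<open>A standard polynomial has the least degree among all polynomials with the same values.\<close>
lemma std_span_polys_le_iff:
  assumes "graded_monomial_order lt" "r \<in> std_span lt (vanishing_ideal (range P))"
  shows "r \<in> polys_le d \<longleftrightarrow> eval_vec P r \<in> RM_code P d"
proof
  assume "eval_vec P r \<in> RM_code P d"
  then obtain f where f: "f \<in> polys_le d" "eval_vec P r = eval_vec P f"
    unfolding RM_code_eq_image by blast
  obtain r' where r': "r' \<in> std_span lt (vanishing_ideal (range P))" "r' \<in> polys_le d"
    "eval_vec P r' = eval_vec P f"
    using eval_normal_form[OF assms(1) f(1)] by metis
  have "r = r'"
    using f(2) r'(3) by (intro std_span_eval_inj[OF assms(1,2) r'(1)]) simp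
  then show "r \<in> polys_le d"
    using r'(2) by simp
qed (simp add: RM_code_eq_image)

text \<open>Here \<open>r\<close> stands for the regularity index. The dimension hypothesis leaves room for exactly one
  standard monomial \<open>a\<close> of degree \<open>r\<close>, and the hypothesis on unit vectors forces \<open>a\<close> to occur in every
  standard indicator function. Then \<open>c \<mapsto> \<Sum>\<^sub>i \<beta>\<^sub>i c\<^sub>i\<close> reads off the coefficient of \<open>a\<close> in the standard
  polynomial with values \<open>c\<close>.\<close>
lemma lead_coef_std_indicator:
  fixes P :: "'m::finite \<Rightarrow> 'k::field ^ 'n::finite" and lt :: "'n monom \<Rightarrow> 'n monom \<Rightarrow> bool"
  assumes P: "inj P" and lt: "graded_monomial_order lt"
    and full: "RM_code P (int r) = UNIV"
    and dim: "vec.dim (RM_code P (int r - 1)) + 1 = CARD('m)"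
    and notin: "\<And>i. axis i 1 \<notin> RM_code P (int r - 1)"
  defines "\<beta> \<equiv> \<lambda>i. lead_coef lt (std_indicator lt P i)"
  shows "\<beta> i \<noteq> 0" and "c \<in> RM_code P (int r - 1) \<Longrightarrow> (\<Sum>i\<in>UNIV. \<beta> i * c $ i) = 0"
proof -
  interpret E: Vector_Spaces.linear pscale "(*s)" "eval_vec P"
    by (rule linear_eval_vec)
  let ?f = "std_indicator lt P"
  let ?std = "std_monoms lt (vanishing_ideal (range P))"
  let ?M = "\<lambda>d::int. {a \<in> ?std. int (monom_deg a) \<le> d}"
  have fin: "finite (?M d)" for d
    by (rule finite_subset[OF _ finite_monoms_deg_le[of d]]) auto
  have sub: "?M (int r - 1) \<subseteq> ?M (int r)"
    by auto
  have "card (?M (int r)) = card (?M (int r - 1)) + 1"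
    using dim unfolding dim_eq_card_std_monoms[OF lt, symmetric]
    by (simp add: full card_cart_basis vec.dimension_def)
  then have "card (?M (int r) - ?M (int r - 1)) = 1"
    unfolding card_Diff_subset[OF fin sub] by simp
  then obtain a where a: "?M (int r) - ?M (int r - 1) = {a}"
    by (rule card_1_singletonE)
  have a_deg: "monom_deg a = r"
    using a by fastforce
  have top: "b = a" if "b \<in> ?std" "int (monom_deg b) \<le> int r" "\<not> int (monom_deg b) \<le> int r - 1" for b
    using that a by blast
  have lead: "lead_monom lt (?f i) = a" and in_keys: "a \<in> Poly_Mapping.keys (?f i)" for i
  proof -
    have std: "?f i \<in> std_span lt (vanishing_ideal (range P))"
      by (rule std_indicator_in_std_span[OF P lt])
    have in_r: "?f i \<in> polys_le (int r)" and notin_r: "?f i \<notin> polys_le (int r - 1)"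
      unfolding std_span_polys_le_iff[OF lt std] eval_std_indicator[OF P lt]
      by (simp_all add: full notin)
    have key: "b = a" if "b \<in> Poly_Mapping.keys (?f i)" "\<not> int (monom_deg b) \<le> int r - 1" for b
      using that std in_r by (intro top) (auto simp: std_span_eq polys_le_def)
    show keys_a: "a \<in> Poly_Mapping.keys (?f i)"
      using notin_r key by (auto simp: polys_le_def)
    show "lead_monom lt (?f i) = a"
    proof (rule lead_monom_eqI[OF graded_imp_monomial_order[OF lt] keys_a])
      show "lt b a" if "b \<in> Poly_Mapping.keys (?f i)" "b \<noteq> a" for b
      proof -
        have "monom_deg b < monom_deg a"
          using key[OF that(1)] that(2) a_deg by linarith
        then show ?thesis
          using lt by (simp add: graded_monomial_order_def)
      qed
    qed
  qed
  have \<beta>: "\<beta> i = Poly_Mapping.lookup (?f i) a" for i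
    by (simp add: \<beta>_def lead_coef_def lead)
  show "\<beta> i \<noteq> 0"
    using in_keys[of i] by (simp add: \<beta> in_keys_iff)
  show "(\<Sum>i\<in>UNIV. \<beta> i * c $ i) = 0" if c: "c \<in> RM_code P (int r - 1)"
  proof -
    \<comment> \<open>The standard polynomial with values \<open>c\<close>; the claim is that its coefficient at \<open>a\<close> is zero.\<close>
    define h where "h = (\<Sum>i\<in>UNIV. pscale (c $ i) (?f i))"
    have "h \<in> std_span lt (vanishing_ideal (range P))"
      unfolding h_def
      by (intro poly_vs.subspace_sum poly_vs.subspace_scale subspace_std_span
          std_indicator_in_std_span[OF P lt])
    moreover have "eval_vec P h = c"
      by (simp add: h_def E.sum E.scale eval_std_indicator[OF P lt] basis_expansion)
    ultimately have "h \<in> polys_le (int r - 1)"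
      using std_span_polys_le_iff[OF lt] c by metis
    then have "a \<notin> Poly_Mapping.keys h"
      using a_deg by (auto simp: polys_le_def)
    then have "Poly_Mapping.lookup h a = 0"
      by (simp add: in_keys_iff)
    then show ?thesis
      by (simp add: h_def lookup_sum \<beta> mult.commute)
  qed
qed

section \<open>The duality criterion\<close>

text \<open>The pairing of \<open>\<beta> \<cdot> f\<close> with \<open>g\<close> is the pairing of \<open>\<beta>\<close> with the product \<open>f g\<close>, whose degree is at most
  \<open>d + e\<close>.\<close>
lemma scaled_RM_code_subset_dual:
  assumes \<beta>: "\<And>c. c \<in> RM_code P (d + e) \<Longrightarrow> (\<Sum>i\<in>UNIV. \<beta> $ i * c $ i) = 0"
  shows "scale_code \<beta> (RM_code P d) \<subseteq> dual_code (RM_code P e)"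
proof -
  have "(\<Sum>i\<in>UNIV. \<beta> $ i * poly_eval f (P i) * poly_eval g (P i)) = 0"
    if "f \<in> polys_le d" "g \<in> polys_le e" for f g
  proof -
    have "eval_vec P (f * g) \<in> RM_code P (d + e)"
      unfolding RM_code_eq_image by (intro imageI polys_le_mult that)
    from \<beta>[OF this] show ?thesis
      by (simp add: poly_eval_mult mult.assoc)
  qed
  then show ?thesis
    by (auto simp: scale_code_def dual_code_def RM_code_eq_image)
qed

lemma dual_RM_code_eq_scaled:
  fixes P :: "'m::finite \<Rightarrow> 'k::field ^ 'n::finite"
  assumes \<beta>: "\<And>i. \<beta> $ i \<noteq> 0"
    and vanish: "\<And>c. c \<in> RM_code P (d + e) \<Longrightarrow> (\<Sum>i\<in>UNIV. \<beta> $ i * c $ i) = 0"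
    and dim: "vec.dim (RM_code P d) + vec.dim (RM_code P e) = CARD('m)"
  shows "dual_code (RM_code P e) = scale_code \<beta> (RM_code P d)"
proof (rule vec.subspace_dim_equal[symmetric])
  show "vec.subspace (scale_code \<beta> (RM_code P d))"
    by (intro subspace_scale_code subspace_RM_code)
  show "vec.subspace (dual_code (RM_code P e))"
    by (rule subspace_dual_code)
  show "scale_code \<beta> (RM_code P d) \<subseteq> dual_code (RM_code P e)"
    using vanish by (rule scaled_RM_code_subset_dual)
  show "vec.dim (scale_code \<beta> (RM_code P d)) \<ge> vec.dim (dual_code (RM_code P e))"
    using dim dim_dual_code[OF subspace_RM_code[of P e]] \<beta> by (simp add: dim_scale_code)
qed

lemma axis_notin_of_dual:
  assumes "\<beta> \<in> dual_code C" "\<beta> $ i \<noteq> 0"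
  shows "axis i 1 \<notin> C"
proof
  assume "axis i 1 \<in> C"
  then have "(\<Sum>j\<in>UNIV. \<beta> $ j * axis i 1 $ j) = 0"
    using assms(1) by (simp add: dual_code_def)
  moreover have "(\<Sum>j\<in>UNIV. \<beta> $ j * axis i 1 $ j) = (\<Sum>j\<in>UNIV. if j = i then \<beta> $ j else 0)"
    by (intro sum.cong) (auto simp: axis_def)
  ultimately show False
    using assms(2) by simp
qed

theorem theorem6p5:
  fixes P :: "'m::finite \<Rightarrow> ('k::{field,finite}) ^ ('n::finite)"
    and X :: "('k ^ 'n) set"
    and I :: "('n, 'k) mpoly set"
    and r0 :: nat
    and lt :: "'n monom \<Rightarrow> 'n monom \<Rightarrow> bool"
  assumes "inj P" and "X = range P" and "card X \<ge> 2"
    and "I = vanishing_ideal X"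
    and "r0 = reg_index (affine_hilbert I) (card X)"
    and "graded_monomial_order lt"
  shows
    "let A = (\<forall>d::int. -1 \<le> d \<and> d \<le> int r0 \<longrightarrow>
               monomially_equivalent (RM_code P d) (dual_code (RM_code P (int r0 - d - 1))));
         B = ((\<forall>d::int. -1 \<le> d \<and> d \<le> int r0 \<longrightarrow>
                affine_hilbert I d + affine_hilbert I (int r0 - d - 1) = card X) \<and>
              (\<forall>p\<in>assoc_primes I. r0 = v_number p I));
         C = (\<lambda>g. g \<in> std_span lt I \<and> (\<forall>i. poly_eval g (P i) \<noteq> 0) \<and>
               (\<forall>d::int. -1 \<le> d \<and> d \<le> int r0 \<longrightarrow>
                 dual_code (RM_code P (int r0 - d - 1)) =
                   scale_code (\<chi> i. poly_eval g (P i)) (RM_code P d)))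
     in (A \<longleftrightarrow> B) \<and> (B \<longleftrightarrow> (\<exists>g. C g)) \<and>
        ((\<exists>g. C g) \<longrightarrow>
          C (\<Sum>i\<in>UNIV. pscale (lead_coef lt (std_indicator lt P i)) (std_indicator lt P i)))"
proof -
  note P = assms(1) and lt = assms(6)
  have card_X: "card X = CARD('m)"
    using P by (simp add: assms(2) card_image)
  have I: "I = vanishing_ideal (range P)"
    using assms(2,4) by simp
  have H: "affine_hilbert I d = vec.dim (RM_code P d)" for d
    unfolding I by (rule affine_hilbert_eq_dim[OF lt])
  have full: "RM_code P (int r0) = UNIV"
    unfolding assms(5) card_X I by (rule RM_code_reg_index[OF P lt])
  have v: "(\<forall>p\<in>assoc_primes I. r0 = v_number p I) \<longleftrightarrow> (\<forall>i. axis i 1 \<notin> RM_code P (int r0 - 1))"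
    using v_number_eq_iff[OF P full] by (simp add: I assoc_primes_vanishing_ideal[OF P])
  define A where "A \<longleftrightarrow> (\<forall>d::int. -1 \<le> d \<and> d \<le> int r0 \<longrightarrow>
    monomially_equivalent (RM_code P d) (dual_code (RM_code P (int r0 - d - 1))))"
  define B where "B \<longleftrightarrow> (\<forall>d::int. -1 \<le> d \<and> d \<le> int r0 \<longrightarrow>
      vec.dim (RM_code P d) + vec.dim (RM_code P (int r0 - d - 1)) = CARD('m)) \<and>
    (\<forall>i. axis i 1 \<notin> RM_code P (int r0 - 1))"
  define C where "C g \<longleftrightarrow> g \<in> std_span lt I \<and> (\<forall>i. poly_eval g (P i) \<noteq> 0) \<and>
    (\<forall>d::int. -1 \<le> d \<and> d \<le> int r0 \<longrightarrow>
      dual_code (RM_code P (int r0 - d - 1)) =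
        scale_code (\<chi> i. poly_eval g (P i)) (RM_code P d))" for g
  define g0 where
    "g0 = (\<Sum>i\<in>UNIV. pscale (lead_coef lt (std_indicator lt P i)) (std_indicator lt P i))"
  have B_if_A: B if A
  proof -
    have equiv: "\<exists>\<beta>. (\<forall>i. \<beta> $ i \<noteq> 0) \<and>
        dual_code (RM_code P (int r0 - d - 1)) = scale_code \<beta> (RM_code P d)"
      if "-1 \<le> d" "d \<le> int r0" for d
      using \<open>A\<close> that by (simp add: A_def monomially_equivalent_def)
    have "vec.dim (RM_code P d) + vec.dim (RM_code P (int r0 - d - 1)) = CARD('m)"
      if d: "-1 \<le> d" "d \<le> int r0" for d
    proof -
      obtain \<beta> where "\<forall>i. \<beta> $ i \<noteq> 0"
        "dual_code (RM_code P (int r0 - d - 1)) = scale_code \<beta> (RM_code P d)"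
        using equiv[OF d] by blast
      then show ?thesis
        using dim_dual_code[OF subspace_RM_code[of P "int r0 - d - 1"]] by (simp add: dim_scale_code)
    qed
    moreover have "axis i 1 \<notin> RM_code P (int r0 - 1)" for i
    proof -
      obtain \<beta> where \<beta>: "\<forall>i. \<beta> $ i \<noteq> 0"
        "dual_code (RM_code P (int r0 - 1)) = scale_code \<beta> (RM_code P 0)"
        using equiv[of 0] by auto
      \<comment> \<open>\<open>\<beta>\<close> is the scaling of the all-ones vector, the value vector of the constant \<open>1\<close>.\<close>
      have "eval_vec P 1 \<in> RM_code P 0"
        unfolding RM_code_eq_image by (intro imageI one_in_polys_le) simp
      moreover have "\<beta> = (\<chi> i. \<beta> $ i * eval_vec P 1 $ i)"
        by (simp add: vec_eq_iff)
      ultimately have "\<beta> \<in> dual_code (RM_code P (int r0 - 1))"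
        unfolding \<beta>(2) scale_code_def by (rule rev_image_eqI)
      then show ?thesis
        using \<beta>(1) by (intro axis_notin_of_dual[of \<beta>]) simp_all
    qed
    ultimately show B
      by (simp add: B_def)
  qed
  have C_if_B: "C g0" if B
  proof -
    define \<beta> where "\<beta> = (\<chi> i. lead_coef lt (std_indicator lt P i))"
    have dim: "vec.dim (RM_code P d) + vec.dim (RM_code P (int r0 - d - 1)) = CARD('m)"
      if "-1 \<le> d" "d \<le> int r0" for d
      using \<open>B\<close> that by (simp add: B_def)
    have "vec.dim (RM_code P (int r0 - 1)) + 1 = CARD('m)"
      using dim[of 0] by (simp add: dim_RM_code_0)
    moreover have "axis i 1 \<notin> RM_code P (int r0 - 1)" for i
      using \<open>B\<close> by (simp add: B_def)
    ultimately have \<beta>: "\<And>i. \<beta> $ i \<noteq> 0"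
      "\<And>c. c \<in> RM_code P (int r0 - 1) \<Longrightarrow> (\<Sum>i\<in>UNIV. \<beta> $ i * c $ i) = 0"
      using lead_coef_std_indicator[OF P lt full] by (simp_all add: \<beta>_def)
    have g0: "poly_eval g0 (P i) = \<beta> $ i" for i
    proof -
      have "poly_eval (std_indicator lt P j) (P i) = axis j 1 $ i" for j
        using eval_std_indicator[OF P lt, of j] by (simp add: vec_eq_iff)
      then have "poly_eval g0 (P i) = (\<Sum>j\<in>UNIV. \<beta> $ j * axis j 1 $ i)"
        by (simp add: g0_def \<beta>_def poly_eval_sum)
      also have "\<dots> = (\<Sum>j\<in>UNIV. if i = j then \<beta> $ j else 0)"
        by (intro sum.cong) (auto simp: axis_def)
      finally show ?thesis by simp
    qed
    have "g0 \<in> std_span lt I"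
      unfolding g0_def I
      by (intro poly_vs.subspace_sum poly_vs.subspace_scale subspace_std_span
          std_indicator_in_std_span[OF P lt])
    moreover have "dual_code (RM_code P (int r0 - d - 1)) = scale_code \<beta> (RM_code P d)"
      if "-1 \<le> d" "d \<le> int r0" for d
      by (rule dual_RM_code_eq_scaled) (use \<beta> dim[OF that] in simp_all)
    ultimately show "C g0"
      using \<beta>(1) by (simp add: C_def g0)
  qed
  have A_if_C: A if "C g" for g
    unfolding A_def monomially_equivalent_def
  proof (intro allI impI exI conjI)
    show "(\<chi> i. poly_eval g (P i)) $ i \<noteq> 0" for i
      using that by (simp add: C_def)
    show "dual_code (RM_code P (int r0 - d - 1)) = scale_code (\<chi> i. poly_eval g (P i)) (RM_code P d)"
      if "-1 \<le> d \<and> d \<le> int r0" for d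
      using \<open>C g\<close> that by (simp add: C_def)
  qed
  have "(A \<longleftrightarrow> B) \<and> (B \<longleftrightarrow> (\<exists>g. C g)) \<and> ((\<exists>g. C g) \<longrightarrow> C g0)"
    using B_if_A C_if_B A_if_C by blast
  then show ?thesis
    unfolding Let_def H v card_X A_def B_def C_def g0_def .
qed

end
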